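(* Let $\Omega\subset\mathbb{R}^d$ be bounded and closed, let $\rho:\Omega\to[0,+\infty)$ be an integrable function, and let $p>0$, $q>0$. For $\varepsilon>0$ and every Borel probability measure $\mu$ on $\Omega$ set $$F_\varepsilon(\mu)=\varepsilon\int_\Omega\frac{\rho(x)}{(\mu(x))^{p/d}}\,dx+\int_{\Omega\times\Omega}|x-y|^q\,d(\mu\otimes\mu)(x,y),$$ where $\mu(x)$ in the first integral denotes the density of the absolutely continuous part of $\mu$ with respect to Lebesgue measure. For each $\varepsilon>0$ let $\mu_\varepsilon$ be a minimizer of $F_\varepsilon$ among all probability measures on $\Omega$. If $\varepsilon_n\to0$ and $\mu_{\varepsilon_n}$ converges weakly* to a probability measure $\mu$ on $\Omega$, then $\mu=\delta_{x_0}$ for some $x_0\in\Omega$ which minimizes over $\Omega$ the function $$x_0\mapsto\int_\Omega(\rho(x))^{1/(1+p/d)}\,|x-x_0|^{q(p/d)/(1+p/d)}\,dx .$$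
   Context: Weak* convergence of probability measures on the compact set $\Omega$ is convergence in duality with the continuous functions on $\Omega$. In the integral $\int_\Omega \rho/\mu^{p/d}\,dx$ only the absolutely continuous part of $\mu$ is considered (the singular part is neglected); the integrand is taken to be $0$ where $\rho=0$, and $+\infty$ where $\rho>0$ and the density of $\mu$ vanishes. *)

theory Defs
  imports "HOL-Probability.Probability"
begin

text \<open>
  A measure on \<open>\<Omega>\<close> has \<open>\<Omega>\<close> itself as its underlying space, equipped with the trace of the
  Borel sets.
\<close>

definition prob_measures_on :: "'a::topological_space set \<Rightarrow> 'a measure set" where
  "prob_measures_on \<Omega> = {\<mu>. prob_space \<mu> \<and> sets \<mu> = sets (restrict_space borel \<Omega>)}"

definition weak_star_tendsto ::
    "'a::topological_space set \<Rightarrow> (nat \<Rightarrow> 'a measure) \<Rightarrow> 'a measure \<Rightarrow> bool" where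
  "weak_star_tendsto \<Omega> \<mu>s \<mu> \<longleftrightarrow>
     (\<forall>f :: 'a \<Rightarrow> real. continuous_on \<Omega> f \<longrightarrow>
        (\<lambda>n. \<integral>x. f x \<partial>\<mu>s n) \<longlonglongrightarrow> (\<integral>x. f x \<partial>\<mu>))"

text \<open>
  Lebesgue decomposition \<open>\<mu> = u dx + \<nu>\<close> on \<open>\<Omega>\<close>, with \<open>\<nu>\<close> carried by a Lebesgue null set.
  The library constant \<open>RN_deriv\<close> is not usable here, as it is \<open>0\<close> whenever \<open>\<mu>\<close> is not
  absolutely continuous.
\<close>

definition is_ac_density ::
    "'a::euclidean_space set \<Rightarrow> 'a measure \<Rightarrow> ('a \<Rightarrow> real) \<Rightarrow> bool" where
  "is_ac_density \<Omega> \<mu> u \<longleftrightarrow>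
     u \<in> borel_measurable (restrict_space lborel \<Omega>) \<and> (\<forall>x\<in>\<Omega>. 0 \<le> u x) \<and>
     (\<exists>\<nu> N. sets \<nu> = sets (restrict_space lborel \<Omega>) \<and>
        N \<in> null_sets (restrict_space lborel \<Omega>) \<and> emeasure \<nu> (\<Omega> - N) = 0 \<and>
        (\<forall>A\<in>sets \<mu>. emeasure \<mu> A =
           emeasure (density (restrict_space lborel \<Omega>) (\<lambda>x. ennreal (u x))) A + emeasure \<nu> A))"

definition ac_density :: "'a::euclidean_space set \<Rightarrow> 'a measure \<Rightarrow> 'a \<Rightarrow> real" where
  "ac_density \<Omega> \<mu> = (SOME u. is_ac_density \<Omega> \<mu> u)"

text \<open>The choice exists, and it does not matter up to null sets:\<close>

lemma is_ac_density_ac_density: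
  fixes \<Omega> :: "'a::euclidean_space set"
  assumes \<Omega>: "\<Omega> \<in> sets borel" and \<mu>: "\<mu> \<in> prob_measures_on \<Omega>"
  shows "is_ac_density \<Omega> \<mu> (ac_density \<Omega> \<mu>)"
proof -
  define L where "L = restrict_space (lborel :: 'a measure) \<Omega>"
  interpret M: prob_space \<mu> using \<mu> by (simp add: prob_measures_on_def)
  have sL: "sets \<mu> = sets L"
    using \<mu> by (simp add: prob_measures_on_def L_def sets_restrict_space)
  have spL: "space L = \<Omega>" by (simp add: L_def space_restrict_space)
  have sp: "space \<mu> = \<Omega>" using sets_eq_imp_space_eq[OF sL] spL by simp
  interpret L: sigma_finite_measure L
    unfolding L_def by (rule sigma_finite_measure_restrict_space)
      (use \<Omega> in \<open>auto intro: lborel.sigma_finite_measure_axioms\<close>)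
  define c where "c = Sup (emeasure \<mu> ` null_sets L)"
  have ne: "emeasure \<mu> ` null_sets L \<noteq> {}" by auto
  obtain g where g: "range g \<subseteq> emeasure \<mu> ` null_sets L" "c = (SUP i::nat. g i)"
    using ennreal_Sup_countable_SUP[OF ne] unfolding c_def by metis
  then have "\<forall>i. \<exists>N. N \<in> null_sets L \<and> g i = emeasure \<mu> N" by blast
  then obtain F where F: "\<And>i. F i \<in> null_sets L" "\<And>i. g i = emeasure \<mu> (F i)" by metis
  define N where "N = (\<Union>i. F i)"
  have N: "N \<in> null_sets L" unfolding N_def using F by blast
  have Nm [measurable]: "N \<in> sets \<mu>" using N sL by auto
  have cN: "c \<le> emeasure \<mu> N"
    unfolding g by (rule SUP_least) (use F sL Nm in \<open>auto intro!: emeasure_mono simp: N_def\<close>)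
  define \<alpha> where "\<alpha> = density \<mu> (indicator (\<Omega> - N))"
  define \<nu> where "\<nu> = density \<mu> (indicator N)"
  have [measurable]: "\<Omega> - N \<in> sets \<mu>" using sp Nm by (metis sets.compl_sets)
  have e\<alpha>: "emeasure \<alpha> A = emeasure \<mu> (A - N)" if A: "A \<in> sets \<mu>" for A
  proof -
    have "(\<Omega> - N) \<inter> A = A - N" using sets.sets_into_space[OF A] sp by auto
    moreover have "emeasure \<alpha> A = emeasure \<mu> ((\<Omega> - N) \<inter> A)"
      unfolding \<alpha>_def using A
      by (subst emeasure_density) (auto simp flip: indicator_inter_arith)
    ultimately show ?thesis by simp
  qed
  have e\<nu>: "emeasure \<nu> A = emeasure \<mu> (N \<inter> A)" if A: "A \<in> sets \<mu>" for A
    unfolding \<nu>_def using A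
    by (subst emeasure_density) (auto simp flip: indicator_inter_arith)
  have s\<alpha>: "sets \<alpha> = sets \<mu>" and sp\<alpha>: "space \<alpha> = \<Omega>" by (auto simp: \<alpha>_def sp)
  have fin: "finite_measure \<alpha>"
    by (rule finite_measureI) (use e\<alpha>[of \<Omega>] sp in \<open>auto simp: sp\<alpha> M.emeasure_eq_measure\<close>)
  have ac: "absolutely_continuous L \<alpha>"
    unfolding absolutely_continuous_def
  proof
    fix A assume A: "A \<in> null_sets L"
    then have Am: "A \<in> sets \<mu>" using sL by auto
    have "A \<union> N \<in> null_sets L" using A N by auto
    then have "emeasure \<mu> (A \<union> N) \<le> c" unfolding c_def by (intro Sup_upper) auto
    with cN have "emeasure \<mu> (A \<union> N) \<le> emeasure \<mu> N" by simp
    moreover have "emeasure \<mu> (A \<union> N) = emeasure \<mu> N + emeasure \<mu> (A - N)"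
      using plus_emeasure[of N \<mu> "A - N"] Am Nm by (auto simp: Un_commute)
    ultimately have "emeasure \<mu> (A - N) = 0"
      by (simp add: M.emeasure_eq_measure measure_le_0_iff flip: ennreal_plus)
    then show "A \<in> null_sets \<alpha>" using e\<alpha>[OF Am] Am s\<alpha> by auto
  qed
  obtain D where D: "D \<in> borel_measurable L" "AE x in L. RN_deriv L \<alpha> x = ennreal (D x)"
      "\<And>x. 0 \<le> D x"
    using L.real_RN_deriv[OF fin ac] s\<alpha> sL by metis
  have dens: "density L (\<lambda>x. ennreal (D x)) = \<alpha>"
  proof -
    have "density L (\<lambda>x. ennreal (D x)) = density L (RN_deriv L \<alpha>)"
      by (rule density_cong) (use D in \<open>auto\<close>)
    also have "\<dots> = \<alpha>" by (rule L.density_RN_deriv[OF ac]) (simp add: s\<alpha> sL)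
    finally show ?thesis .
  qed
  have "is_ac_density \<Omega> \<mu> D"
    unfolding is_ac_density_def L_def[symmetric] dens
  proof (intro conjI exI[of _ \<nu>] exI[of _ N] ballI)
    show "emeasure \<nu> (\<Omega> - N) = 0" by (subst e\<nu>) auto
    fix A assume A: "A \<in> sets \<mu>"
    show "emeasure \<mu> A = emeasure \<alpha> A + emeasure \<nu> A"
      unfolding e\<alpha>[OF A] e\<nu>[OF A]
      using plus_emeasure[of "A - N" \<mu> "N \<inter> A"] A Nm
      by (metis Int_commute Diff_Int_distrib2 Un_Diff_Int Diff_disjoint Int_assoc inf_bot_right sets.Diff sets.Int Int_Diff)
  qed (use D N sL in \<open>auto simp: \<nu>_def\<close>)
  then show ?thesis unfolding ac_density_def by (rule someI[of "is_ac_density \<Omega> \<mu>"])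
qed

lemma is_ac_density_unique:
  fixes \<Omega> :: "'a::euclidean_space set"
  assumes \<Omega>: "\<Omega> \<in> sets borel" and \<mu>: "\<mu> \<in> prob_measures_on \<Omega>"
    and u: "is_ac_density \<Omega> \<mu> u" and v: "is_ac_density \<Omega> \<mu> v"
  shows "AE x in restrict_space lborel \<Omega>. u x = v x"
proof -
  define L where "L = restrict_space (lborel :: 'a measure) \<Omega>"
  have sL: "sets \<mu> = sets L"
    using \<mu> by (simp add: prob_measures_on_def L_def sets_restrict_space)
  have spL: "space L = \<Omega>" by (simp add: L_def space_restrict_space)
  interpret L: sigma_finite_measure L
    unfolding L_def by (rule sigma_finite_measure_restrict_space)
      (use \<Omega> in \<open>auto intro: lborel.sigma_finite_measure_axioms\<close>)
  have key: "\<exists>N\<in>null_sets L. \<forall>A\<in>sets L. A \<inter> N = {} \<longrightarrow>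
      emeasure (density L (\<lambda>x. ennreal (w x))) A = emeasure \<mu> A"
    if w: "is_ac_density \<Omega> \<mu> w" for w
  proof -
    obtain \<nu> N where h: "sets \<nu> = sets L" "N \<in> null_sets L" "emeasure \<nu> (\<Omega> - N) = 0"
      "\<And>A. A\<in>sets \<mu> \<Longrightarrow> emeasure \<mu> A = emeasure (density L (\<lambda>x. ennreal (w x))) A + emeasure \<nu> A"
      using w unfolding is_ac_density_def L_def[symmetric] by blast
    have "emeasure \<nu> A = 0" if A: "A \<in> sets L" "A \<inter> N = {}" for A
    proof -
      have "A \<subseteq> \<Omega> - N" using A sets.sets_into_space[OF A(1)] spL by auto
      moreover have "\<Omega> - N \<in> sets \<nu>" using h spL by (metis null_setsD2 sets.compl_sets)
      ultimately show ?thesis using emeasure_mono[of A "\<Omega> - N" \<nu>] h(3) by simp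
    qed
    then show ?thesis using h sL by (intro bexI[of _ N]) auto
  qed
  obtain N1 where N1: "N1 \<in> null_sets L" "\<And>A. A\<in>sets L \<Longrightarrow> A \<inter> N1 = {} \<Longrightarrow>
      emeasure (density L (\<lambda>x. ennreal (u x))) A = emeasure \<mu> A" using key[OF u] by blast
  obtain N2 where N2: "N2 \<in> null_sets L" "\<And>A. A\<in>sets L \<Longrightarrow> A \<inter> N2 = {} \<Longrightarrow>
      emeasure (density L (\<lambda>x. ennreal (v x))) A = emeasure \<mu> A" using key[OF v] by blast
  have um: "(\<lambda>x. ennreal (u x)) \<in> borel_measurable L"
    and vm: "(\<lambda>x. ennreal (v x)) \<in> borel_measurable L"
    using u v by (auto simp: is_ac_density_def L_def intro!: measurable_compose[OF _ measurable_ennreal])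
  define N where "N = N1 \<union> N2"
  have N: "N \<in> null_sets L" "N \<in> sets L" using N1 N2 by (auto simp: N_def)
  have red: "emeasure (density L (\<lambda>x. ennreal (w x))) A = emeasure (density L (\<lambda>x. ennreal (w x))) (A - N)"
    if A: "A \<in> sets L" and wm: "(\<lambda>x. ennreal (w x)) \<in> borel_measurable L" for A w
  proof -
    have "N \<in> null_sets (density L (\<lambda>x. ennreal (w x)))"
      using absolutely_continuousI_density[OF wm] N by (auto simp: absolutely_continuous_def)
    then show ?thesis using emeasure_Diff_null_set[of N _ A] A by simp
  qed
  have "density L (\<lambda>x. ennreal (u x)) = density L (\<lambda>x. ennreal (v x))"
  proof (rule measure_eqI)
    fix A assume "A \<in> sets (density L (\<lambda>x. ennreal (u x)))"
    then have A: "A \<in> sets L" by simp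
    then have A': "A - N \<in> sets L" "(A - N) \<inter> N1 = {}" "(A - N) \<inter> N2 = {}"
      using N by (auto simp: N_def)
    show "emeasure (density L (\<lambda>x. ennreal (u x))) A = emeasure (density L (\<lambda>x. ennreal (v x))) A"
      using red[OF A um] red[OF A vm] N1(2)[OF A'(1,2)] N2(2)[OF A'(1,3)] by simp
  qed simp
  then have "AE x in L. ennreal (u x) = ennreal (v x)"
    using L.density_unique_iff[OF um vm] by simp
  moreover have "\<And>x. x \<in> space L \<Longrightarrow> 0 \<le> u x \<and> 0 \<le> v x"
    using u v spL by (auto simp: is_ac_density_def)
  ultimately show ?thesis unfolding L_def[symmetric] by (auto elim!: AE_mp intro!: AE_I2)
qed

definition location_integrand :: "real \<Rightarrow> real \<Rightarrow> real \<Rightarrow> ennreal" where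
  "location_integrand a r m =
     (if r = 0 then 0 else if m = 0 then \<infinity> else ennreal (r / m powr a))"

definition F_eps ::
    "(real^'d) set \<Rightarrow> (real^'d \<Rightarrow> real) \<Rightarrow> real \<Rightarrow> real \<Rightarrow> real \<Rightarrow> (real^'d) measure \<Rightarrow> ennreal" where
  "F_eps \<Omega> \<rho> p q \<epsilon> \<mu> =
     ennreal \<epsilon> * (\<integral>\<^sup>+x. location_integrand (p / CARD('d)) (\<rho> x) (ac_density \<Omega> \<mu> x) \<partial>lebesgue_on \<Omega>)
     + (\<integral>\<^sup>+z. ennreal (dist (fst z) (snd z) powr q) \<partial>(\<mu> \<Otimes>\<^sub>M \<mu>))"

definition limit_cost ::
    "(real^'d) set \<Rightarrow> (real^'d \<Rightarrow> real) \<Rightarrow> real \<Rightarrow> real \<Rightarrow> real^'d \<Rightarrow> real" where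
  "limit_cost \<Omega> \<rho> p q x0 =
     (let a = p / CARD('d) in
      \<integral>x. \<rho> x powr (1 / (1 + a)) * dist x x0 powr (q * a / (1 + a)) \<partial>lebesgue_on \<Omega>)"

end

theory Submission
  imports Defs
begin

text \<open>
  Write \<open>a = p/d\<close>, \<open>s = 1/(1+a)\<close> and \<open>t = a/(1+a)\<close>. If almost all the mass of \<open>\<mu>\<close> sits near
  \<open>x0\<close>, the interaction is essentially \<open>2 \<integral> |x - x0|\<^sup>q u dx\<close>, where \<open>u\<close> is the density of \<open>\<mu>\<close>, and
  minimizing \<open>\<epsilon> \<rho> / u\<^sup>a + 2 |x - x0|\<^sup>q u\<close> pointwise over \<open>u\<close> gives
  \<open>\<epsilon>\<^sup>s\<close> times a constant multiple of \<open>\<rho>\<^sup>s |x - x0|\<close> to the power \<open>q t\<close>. A Dirac mass plus the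
  optimal density shows that the minima are \<open>O(\<epsilon>\<^sup>s)\<close>; so the interaction energy of the minimizers
  tends to zero, which forces the weak* limit to be a Dirac mass at some \<open>x0\<close>. Young's inequality
  bounds the minima from below by the limit cost at \<open>x0\<close>, and comparison with the competitors
  for an arbitrary \<open>y\<close>, divided by \<open>\<epsilon>\<^sup>s\<close>, shows that \<open>x0\<close> is optimal.
\<close>

section \<open>Pointwise minimization\<close>

text \<open>
  The minimum over \<open>u > 0\<close> of \<open>A / u\<^sup>a + w u\<close> is this constant times the product of
  \<open>A powr (1 / (1 + a))\<close> and \<open>w powr (a / (1 + a))\<close>.
\<close>

definition energy_const :: "real \<Rightarrow> real" where
  "energy_const a = (1 + a) * a powr - (a / (1 + a))"

lemma energy_const_pos: "0 < a \<Longrightarrow> 0 < energy_const a"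
  by (simp add: energy_const_def)

text \<open>The two summands are the shares of \<open>A / u powr a\<close> and \<open>w * u\<close>
  at the minimizer. They add up because \<open>1 / (1 + a)\<close> equals
  \<open>1 - a / (1 + a)\<close>.\<close>

lemma energy_const_split:
  assumes "0 < a"
  shows "energy_const a = a powr - (a / (1 + a)) + a powr (1 / (1 + a))"
proof -
  have "a powr (1 / (1 + a)) = a powr (1 + - (a / (1 + a)))"
    using assms by (intro arg_cong[where f = "\<lambda>t. a powr t"]) (simp add: field_simps)
  also have "\<dots> = a * a powr - (a / (1 + a))"
    unfolding powr_add using assms by simp
  finally show ?thesis by (simp add: energy_const_def algebra_simps)
qed

text \<open>Weighted Young inequality with weights \<open>s\<close> and \<open>t\<close>, which sum
  to 1. The relation \<open>t = a * s\<close> makes the powers of \<open>u\<close> cancel, so the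
  bound is uniform in \<open>u\<close>.\<close>

lemma energy_const_le:
  fixes a A w u :: real
  assumes "0 < a" "0 < A" "0 \<le> w" "0 < u"
  shows "energy_const a * A powr (1 / (1 + a)) * w powr (a / (1 + a)) \<le> A / u powr a + w * u"
proof (cases "w = 0")
  case True
  with assms show ?thesis by simp
next
  case False
  with assms have w: "0 < w" by simp
  define s t where "s = 1 / (1 + a)" and "t = a / (1 + a)"
  have st: "0 < s" "0 < t" "s + t = 1" "t = a * s"
    using assms(1) by (auto simp: s_def t_def field_simps)
  have as: "1 / s = 1 + a" "1 / t = (1 + a) / a" using assms(1) by (auto simp: s_def t_def)
  have "(A / u powr a / s) powr s * (w * u / t) powr t \<le> s * (A / u powr a / s) + t * (w * u / t)"
    by (rule Youngs_inequality_0) (use st assms w in auto)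
  also have "\<dots> = A / u powr a + w * u" using st(1,2) by simp
  also have "(A / u powr a / s) powr s * (w * u / t) powr t
      = (1 / s) powr s * (1 / t) powr t * A powr s * w powr t * (u powr t / u powr (a * s))"
    using st assms w by (simp add: powr_divide powr_mult powr_powr mult_ac)
  also have "u powr t / u powr (a * s) = 1" using assms(4) st(4) by simp
  also have "(1 / s) powr s * (1 / t) powr t = (1 + a) powr s * (1 + a) powr t * a powr - t"
    unfolding as using assms by (simp add: powr_divide powr_minus_divide)
  also have "\<dots> = energy_const a"
    unfolding energy_const_def using st assms
    by (simp flip: powr_add t_def)
  finally show ?thesis by (simp add: s_def t_def)
qed

text \<open>This \<open>u\<close> is the critical point: the derivative
  \<open>w - a * A / u powr (a + 1)\<close> vanishes there, so the lower bound is attained.\<close>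

lemma energy_const_eq:
  fixes a A w :: real
  assumes "0 < a" "0 < A" "0 < w"
  defines "u \<equiv> (a * A / w) powr (1 / (1 + a))"
  shows "A / u powr a + w * u = energy_const a * A powr (1 / (1 + a)) * w powr (a / (1 + a))"
proof -
  define s t where "s = 1 / (1 + a)" and "t = a / (1 + a)"
  have st: "0 < s" "0 < t" "s + t = 1" "t = a * s"
    using assms(1) by (auto simp: s_def t_def field_simps)
  \<comment> \<open>Writing \<open>A\<close> and \<open>w\<close> as such products lets the powers
    coming from \<open>u\<close> cancel exactly.\<close>
  have split: "z = z powr s * z powr t" if "0 < z" for z :: real
    using that st by (simp flip: powr_add)
  have u: "u = a powr s * A powr s / w powr s"
    using assms by (simp add: u_def s_def powr_mult powr_divide)
  have "u powr a = a powr t * A powr t / w powr t"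
    unfolding u using assms st by (simp add: powr_mult powr_divide powr_powr mult_ac)
  then have "A / u powr a = A powr s * A powr t / (a powr t * A powr t / w powr t)"
    using split[OF assms(2)] by simp
  also have "\<dots> = a powr - t * A powr s * w powr t"
    using assms by (simp add: powr_minus_divide)
  finally have 1: "A / u powr a = a powr - t * A powr s * w powr t" .
  have "w * u = w powr s * w powr t * u" using split[OF assms(3)] by simp
  also have "\<dots> = a powr s * A powr s * w powr t" unfolding u using assms by simp
  finally show ?thesis
    unfolding 1 energy_const_split[OF assms(1)] s_def[symmetric] t_def[symmetric]
    by (simp add: algebra_simps)
qed

text \<open>Carries the real inequality over to the extended integrand. For \<open>r = 0\<close> the
  left side is 0; for \<open>r > 0\<close> and \<open>u = 0\<close> the right side is
  infinite.\<close>

lemma location_integrand_lower: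
  assumes "0 < a" "0 < e" "0 \<le> r" "0 \<le> w" "0 \<le> u"
  shows "ennreal (energy_const a * (e * r) powr (1 / (1 + a)) * w powr (a / (1 + a)))
    \<le> ennreal e * location_integrand a r u + ennreal (w * u)"
proof -
  consider "r = 0" | "r > 0" "u = 0" | "r > 0" "u > 0" using assms by fastforce
  then show ?thesis
  proof cases
    case 2
    with assms show ?thesis by (simp add: location_integrand_def ennreal_mult_top)
  next
    case 3
    then show ?thesis
      using energy_const_le[of a "e * r" w u] assms
      by (simp add: location_integrand_def flip: ennreal_plus ennreal_mult)
  qed simp
qed

text \<open>Where \<open>r = 0\<close> the optimal density is 0 as well, and the convention for the
  integrand makes both sides vanish.\<close>

lemma location_integrand_optimal:
  assumes "0 < a" "0 < e" "0 \<le> r" "0 < w"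
  defines "u \<equiv> (a * (e * r) / w) powr (1 / (1 + a))"
  shows "ennreal e * location_integrand a r u + ennreal (w * u)
    = ennreal (energy_const a * (e * r) powr (1 / (1 + a)) * w powr (a / (1 + a)))"
proof (cases "r = 0")
  case True
  then show ?thesis by (simp add: location_integrand_def u_def)
next
  case False
  with assms have "0 < u" by (simp add: u_def)
  with False show ?thesis
    using energy_const_eq[of a "e * r" w] assms
    by (simp add: location_integrand_def u_def flip: ennreal_plus ennreal_mult)
qed

section \<open>A density plus a Dirac mass\<close>

text \<open>Induction over nonnegative measurable functions, starting from indicators. In the limit
  step, monotonicity of the integrals in \<open>i\<close> lets the supremum split over the
  sum.\<close>

lemma nn_integral_add_measure:
  fixes f :: "'a \<Rightarrow> ennreal"
  assumes sets: "sets M = sets N" "sets K = sets N"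
    and em: "\<And>A. A \<in> sets N \<Longrightarrow> emeasure K A = emeasure M A + emeasure N A"
    and f: "f \<in> borel_measurable N"
  shows "(\<integral>\<^sup>+x. f x \<partial>K) = (\<integral>\<^sup>+x. f x \<partial>M) + (\<integral>\<^sup>+x. f x \<partial>N)"
proof -
  note sets_eq_imp_space_eq[OF sets(1), simp] sets_eq_imp_space_eq[OF sets(2), simp]
  note m [simp] = measurable_cong_sets[OF sets(1) refl] measurable_cong_sets[OF sets(2) refl]
  show ?thesis
    using f
  proof (induction rule: borel_measurable_induct)
    case (cong f g)
    then show ?case using nn_integral_cong[of K f g] nn_integral_cong[of M f g] nn_integral_cong[of N f g]
      by simp
  next
    case (set A)
    then show ?case using em sets by simp
  next
    case (mult u c)
    then show ?case by (simp add: nn_integral_cmult distrib_left)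
  next
    case (add u v)
    then show ?case by (simp add: nn_integral_add algebra_simps)
  next
    case (seq U)
    have mono: "mono (\<lambda>i. \<integral>\<^sup>+x. U i x \<partial>L)" for L :: "'a measure"
      using seq(3) by (auto simp: mono_def le_fun_def intro!: nn_integral_mono)
    have "(\<integral>\<^sup>+x. (SUP i. U i) x \<partial>L) = (SUP i. \<integral>\<^sup>+x. U i x \<partial>L)" 
      if "sets L = sets N" for L
      using nn_integral_monotone_convergence_SUP[OF seq(3), of L] seq(1) measurable_cong_sets[OF that refl]
      by (auto simp: image_comp)
    from this[of K] this[of M] this[of N] show ?case
      using sets seq.IH seq(4) mono by (simp add: ennreal_SUP_add image_comp)
  qed
qed

text \<open>Builds the competitors: density \<open>u\<close> of mass \<open>m\<close>, with the
  remaining mass \<open>1 - m\<close> placed at \<open>y\<close>. The point mass does not change the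
  location term and has no interaction with itself.\<close>

lemma ex_density_add_dirac:
  fixes \<Omega> :: "'a::euclidean_space set" and u :: "'a \<Rightarrow> real"
  assumes \<Omega>: "\<Omega> \<in> sets borel" and y: "y \<in> \<Omega>"
    and u: "u \<in> borel_measurable (restrict_space lborel \<Omega>)" "\<And>x. x \<in> \<Omega> \<Longrightarrow> 0 \<le> u x"
    and m: "(\<integral>\<^sup>+x. u x \<partial>restrict_space lborel \<Omega>) = ennreal m" "0 \<le> m" "m \<le> 1"
  obtains \<nu> where "\<nu> \<in> prob_measures_on \<Omega>" "is_ac_density \<Omega> \<nu> u"
    "\<And>f :: 'a \<Rightarrow> ennreal. f \<in> borel_measurable (restrict_space borel \<Omega>) \<Longrightarrow>
       (\<integral>\<^sup>+x. f x \<partial>\<nu>) = (\<integral>\<^sup>+x. u x * f x \<partial>restrict_space lborel \<Omega>) + ennreal (1 - m) * f y"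
proof -
  define L where "L = restrict_space (lborel :: 'a measure) \<Omega>"
  define B where "B = restrict_space (borel :: 'a measure) \<Omega>"
  define M where "M = density L (\<lambda>x. ennreal (u x))"
  define N where "N = scale_measure (ennreal (1 - m)) (return B y)"
  define K where "K = measure_of \<Omega> (sets B) (\<lambda>A. emeasure M A + emeasure N A)"
  have sB: "sets L = sets B" by (simp add: L_def B_def sets_restrict_space)
  have spL: "space L = \<Omega>" and spB: "space B = \<Omega>" by (auto simp: L_def B_def space_restrict_space)
  have sM: "sets M = sets B" and sN: "sets N = sets B" by (auto simp: M_def N_def sB)
  have sK: "sets K = sets B"
    unfolding K_def using sets.space_closed[of B] spB sets.sigma_sets_eq[of B] by simp
  have eK: "emeasure K A = emeasure M A + emeasure N A" if "A \<in> sets B" for A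
  proof (rule emeasure_measure_of[OF K_def])
    show "sets B \<subseteq> Pow \<Omega>" using sets.space_closed[of B] spB by simp
    show "A \<in> sets K" using that sK by simp
    show "positive (sets K) (\<lambda>A. emeasure M A + emeasure N A)" by (simp add: positive_def)
    show "countably_additive (sets K) (\<lambda>A. emeasure M A + emeasure N A)"
    proof (rule countably_additiveI)
      fix F :: "nat \<Rightarrow> 'a set" assume F: "range F \<subseteq> sets K" "disjoint_family F"
      have "(\<Sum>i. emeasure M (F i) + emeasure N (F i)) = (\<Sum>i. emeasure M (F i)) + (\<Sum>i. emeasure N (F i))"
        by (rule suminf_add[symmetric]) auto
      then show "(\<Sum>i. emeasure M (F i) + emeasure N (F i)) = emeasure M (\<Union> (range F)) + emeasure N (\<Union> (range F))"
        using F sM sN sK by (simp add: suminf_emeasure)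
    qed
  qed
  have um [measurable]: "(\<lambda>x. ennreal (u x)) \<in> borel_measurable L" using u by (auto simp: L_def)
  have yB: "{y} \<in> sets B" using y unfolding B_def by (subst sets_restrict_space_iff) (use \<Omega> in auto)
  have int: "(\<integral>\<^sup>+x. f x \<partial>K) = (\<integral>\<^sup>+x. u x * f x \<partial>L) + ennreal (1 - m) * f y"
    if f: "f \<in> borel_measurable B" for f :: "'a \<Rightarrow> ennreal"
  proof -
    have fL: "f \<in> borel_measurable L" and fN: "f \<in> borel_measurable N"
      using f measurable_cong_sets[OF sB refl] measurable_cong_sets[OF sN refl] by auto
    have "(\<integral>\<^sup>+x. f x \<partial>K) = (\<integral>\<^sup>+x. f x \<partial>M) + (\<integral>\<^sup>+x. f x \<partial>N)"
      by (rule nn_integral_add_measure) (use sM sN sK eK fN in auto)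
    also have "(\<integral>\<^sup>+x. f x \<partial>M) = (\<integral>\<^sup>+x. u x * f x \<partial>L)"
      unfolding M_def by (rule nn_integral_density[OF um fL])
    also have "(\<integral>\<^sup>+x. f x \<partial>N) = ennreal (1 - m) * f y"
      unfolding N_def using f y spB by (simp add: nn_integral_scale_measure nn_integral_return)
    finally show ?thesis .
  qed
  have "emeasure K (space K) = 1"
    using int[of "\<lambda>_. 1"] m by (simp add: L_def[symmetric] flip: ennreal_plus)
  then have "prob_space K" by (rule prob_spaceI)
  then have "K \<in> prob_measures_on \<Omega>" using sK by (simp add: prob_measures_on_def B_def)
  \<comment> \<open>The singular part is the point mass \<open>N\<close>, carried by the Lebesgue
    null set \<open>{y}\<close>; so \<open>u\<close> is the density of the whole absolutely
    continuous part.\<close>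
  moreover have "is_ac_density \<Omega> K u"
    unfolding is_ac_density_def
  proof (intro conjI exI[of _ N] exI[of _ "{y}"] ballI)
    show "sets N = sets (restrict_space lborel \<Omega>)" using sN sB L_def by simp
    show "{y} \<in> null_sets (restrict_space lborel \<Omega>)"
      using yB sB \<Omega> y by (auto simp: null_sets_def emeasure_restrict_space L_def)
    show "emeasure N (\<Omega> - {y}) = 0"
      using yB spB sets.compl_sets[OF yB] by (simp add: N_def)
    show "emeasure K A = emeasure (density (restrict_space lborel \<Omega>) (\<lambda>x. ennreal (u x))) A + emeasure N A"
      if "A \<in> sets K" for A using eK that sK by (simp add: M_def L_def)
  qed (use u in auto)
  ultimately show ?thesis
    using that[of K] int by (simp add: L_def B_def)
qed

section \<open>Passing between Lebesgue and Borel measurability on \<open>\<Omega>\<close>, and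
  integrability of powers\<close>

lemma nn_integral_lebesgue_on:
  assumes "\<Omega> \<in> sets borel"
  shows "(\<integral>\<^sup>+x. f x \<partial>lebesgue_on \<Omega>) = (\<integral>\<^sup>+x. f x \<partial>restrict_space lborel \<Omega>)"
  using assms by (simp add: nn_integral_restrict_space nn_integral_completion)

lemma AE_lebesgue_on_iff:
  assumes "\<Omega> \<in> sets borel"
  shows "(AE x in lebesgue_on \<Omega>. P x) \<longleftrightarrow> (AE x in restrict_space lborel \<Omega>. P x)"
  using assms by (simp add: AE_restrict_space_iff AE_completion_iff)

lemma measurable_lebesgue_on:
  assumes "f \<in> measurable (restrict_space lborel \<Omega>) N"
  shows "f \<in> measurable (lebesgue_on \<Omega>) N"
proof (rule measurableI)
  fix A assume "A \<in> sets N"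
  then have "f -` A \<inter> \<Omega> \<in> sets (restrict_space lborel \<Omega>)"
    using measurable_sets[OF assms] by (simp add: space_restrict_space)
  then show "f -` A \<inter> space (lebesgue_on \<Omega>) \<in> sets (lebesgue_on \<Omega>)"
    by (auto simp: sets_restrict_space space_restrict_space)
qed (use measurable_space[OF assms] in \<open>simp add: space_restrict_space\<close>)

text \<open>For \<open>s\<close> between 0 and 1, \<open>\<rho> x powr s\<close> is at most
  \<open>1 + \<rho> x\<close>, which is integrable over a finite measure; the other factor is
  bounded.\<close>

lemma integrable_powr_mult:
  fixes \<rho> \<phi> :: "'a \<Rightarrow> real"
  assumes \<rho>: "integrable M \<rho>" "\<And>x. x \<in> space M \<Longrightarrow> 0 \<le> \<rho> x" and fin: "finite_measure M"
    and s: "0 \<le> s" "s \<le> 1"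
    and \<phi>: "\<phi> \<in> borel_measurable M" "\<And>x. x \<in> space M \<Longrightarrow> \<bar>\<phi> x\<bar> \<le> B"
  shows "integrable M (\<lambda>x. \<rho> x powr s * \<phi> x)"
proof (rule Bochner_Integration.integrable_bound)
  interpret finite_measure M by fact
  show "integrable M (\<lambda>x. (1 + \<rho> x) * B)" using \<rho>(1) by auto
  show "(\<lambda>x. \<rho> x powr s * \<phi> x) \<in> borel_measurable M" using \<rho>(1) \<phi>(1) by measurable
  show "AE x in M. norm (\<rho> x powr s * \<phi> x) \<le> norm ((1 + \<rho> x) * B)"
  proof (rule AE_I2)
    fix x assume x: "x \<in> space M"
    have r: "0 \<le> \<rho> x" by (rule \<rho>(2)[OF x])
    have "\<rho> x powr s \<le> (1 + \<rho> x) powr s" using r s by (intro powr_mono2) auto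
    also have "\<dots> \<le> (1 + \<rho> x) powr 1" using r s by (intro powr_mono) auto
    finally have "\<rho> x powr s \<le> 1 + \<rho> x" using r by simp
    moreover have "\<bar>\<phi> x\<bar> \<le> \<bar>B\<bar>" using \<phi>(2)[OF x] by linarith
    ultimately show "norm (\<rho> x powr s * \<phi> x) \<le> norm ((1 + \<rho> x) * B)"
      using r by (auto simp: abs_mult intro!: mult_mono)
  qed
qed

lemma finite_measure_lebesgue_on:
  assumes "bounded \<Omega>" "closed \<Omega>"
  shows "finite_measure (lebesgue_on (\<Omega> :: 'a::euclidean_space set))"
  using assms emeasure_bounded_finite[of \<Omega>]
  by (intro finite_measureI) (simp add: space_restrict_space emeasure_restrict_space)

lemma measurable_dist_powr [measurable]:
  "(\<lambda>z. dist (fst z) (snd z) powr q)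
    \<in> borel_measurable (restrict_space borel \<Omega> \<Otimes>\<^sub>M restrict_space (borel :: 'a::euclidean_space measure) \<Omega>)"
proof -
  have [measurable]: "(\<lambda>x. x) \<in> restrict_space borel \<Omega> \<rightarrow>\<^sub>M (borel :: 'a measure)"
    by (rule measurable_restrict_space1) simp
  show ?thesis by measurable
qed

section \<open>Lower bound\<close>

text \<open>
  The factor 2 comes from the two orders of a pair with one point in the ball and the other
  outside of it.
\<close>

lemma interaction_lower:
  fixes \<Omega> :: "'a::euclidean_space set"
  assumes \<Omega>: "\<Omega> \<in> sets borel" and \<nu>: "\<nu> \<in> prob_measures_on \<Omega>" and q: "0 < q"
    and \<theta>: "0 \<le> \<theta>" "ennreal \<theta> \<le> emeasure \<nu> (\<Omega> \<inter> ball x0 r)"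
  shows "ennreal (2 * \<theta>) * (\<integral>\<^sup>+x. max (dist x x0 - r) 0 powr q \<partial>\<nu>)
    \<le> (\<integral>\<^sup>+z. ennreal (dist (fst z) (snd z) powr q) \<partial>(\<nu> \<Otimes>\<^sub>M \<nu>))"
proof -
  interpret prob_space \<nu> using \<nu> by (simp add: prob_measures_on_def)
  have s [measurable_cong]: "sets \<nu> = sets (restrict_space borel \<Omega>)"
    using \<nu> by (simp add: prob_measures_on_def)
  have sp: "space \<nu> = \<Omega>" using sets_eq_imp_space_eq[OF s] by (simp add: space_restrict_space)
  have [measurable]: "(\<lambda>x. x) \<in> \<nu> \<rightarrow>\<^sub>M borel"
    unfolding measurable_cong_sets[OF s refl] by (rule measurable_restrict_space1) simp
  define B where "B = \<Omega> \<inter> ball x0 r"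
  have B [measurable]: "B \<in> sets \<nu>" using s \<Omega> by (auto simp: B_def sets_restrict_space)
  define h where "h x = ennreal (max (dist x x0 - r) 0 powr q)" for x
  have [measurable]: "h \<in> borel_measurable \<nu>" unfolding h_def by measurable
  define c where "c z = ennreal (dist (fst z) (snd z) powr q)" for z :: "'a \<times> 'a"
  have [measurable]: "c \<in> borel_measurable (\<nu> \<Otimes>\<^sub>M \<nu>)" unfolding c_def by measurable
  \<comment> \<open>If \<open>y\<close> lies in the ball, the triangle inequality gives
    \<open>dist x x0 - r \<le> dist x y\<close>. Since \<open>h\<close> vanishes on
    \<open>B\<close>, at most one of the two summands is nonzero, so they never compete for the same
    cost.\<close>
  have split: "h x * indicator B y + indicator B x * h y \<le> c (x, y)" if "x \<in> \<Omega>" "y \<in> \<Omega>" for x y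
  proof -
    have "h z = 0" if "z \<in> B" for z using that by (simp add: h_def B_def dist_commute)
    moreover have h: "h z \<le> ennreal (dist z z' powr q)" if "z' \<in> B" for z z'
    proof -
      have "max (dist z x0 - r) 0 \<le> dist z z'"
        using that dist_triangle[of z x0 z'] dist_commute[of x0 z'] by (simp add: B_def)
      then show ?thesis unfolding h_def using q by (intro ennreal_leI powr_mono2) auto
    qed
    moreover have "h z \<le> ennreal (dist z' z powr q)" if "z' \<in> B" for z z'
      by (subst dist_commute) (rule h[OF that])
    ultimately show ?thesis by (auto simp: indicator_def c_def)
  qed
  have "ennreal (2 * \<theta>) * integral\<^sup>N \<nu> h = ennreal \<theta> * integral\<^sup>N \<nu> h + ennreal \<theta> * integral\<^sup>N \<nu> h"
    using \<theta>(1) ennreal_plus[of \<theta> \<theta>] by (simp add: mult.assoc del: ennreal_plus flip: mult_2)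
  also have "\<dots> \<le> emeasure \<nu> B * integral\<^sup>N \<nu> h + emeasure \<nu> B * integral\<^sup>N \<nu> h"
    using \<theta>(2) by (intro add_mono mult_right_mono) (auto simp: B_def)
  also have "\<dots> = (\<integral>\<^sup>+x. \<integral>\<^sup>+y. h x * indicator B y + indicator B x * h y \<partial>\<nu> \<partial>\<nu>)"
    by (simp add: nn_integral_add nn_integral_cmult nn_integral_multc mult.commute)
  also have "\<dots> \<le> (\<integral>\<^sup>+x. \<integral>\<^sup>+y. c (x, y) \<partial>\<nu> \<partial>\<nu>)"
    by (intro nn_integral_mono split) (auto simp: sp)
  also have "\<dots> = (\<integral>\<^sup>+z. c z \<partial>(\<nu> \<Otimes>\<^sub>M \<nu>))" by (rule nn_integral_fst) measurable
  finally show ?thesis by (simp add: h_def[abs_def] c_def[abs_def])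
qed

text \<open>The singular part is a nonnegative measure, so dropping it from the decomposition can
  only lower the integral.\<close>

lemma nn_integral_ac_density_le:
  fixes \<Omega> :: "'a::euclidean_space set" and f :: "'a \<Rightarrow> ennreal"
  assumes \<nu>: "\<nu> \<in> prob_measures_on \<Omega>" and u: "is_ac_density \<Omega> \<nu> u"
    and f: "f \<in> borel_measurable (restrict_space borel \<Omega>)"
  shows "(\<integral>\<^sup>+x. u x * f x \<partial>restrict_space lborel \<Omega>) \<le> (\<integral>\<^sup>+x. f x \<partial>\<nu>)"
proof -
  define L where "L = restrict_space (lborel :: 'a measure) \<Omega>"
  have s: "sets \<nu> = sets L"
    using \<nu> by (simp add: prob_measures_on_def L_def sets_restrict_space)
  have "sets (restrict_space borel \<Omega>) = sets L" by (simp add: L_def sets_restrict_space)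
  from measurable_cong_sets[OF this refl] f have fL: "f \<in> borel_measurable L" by auto
  have "u \<in> borel_measurable L" using u by (simp add: is_ac_density_def L_def)
  then have "(\<integral>\<^sup>+x. u x * f x \<partial>L) = (\<integral>\<^sup>+x. f x \<partial>density L (\<lambda>x. ennreal (u x)))"
    using fL by (simp add: nn_integral_density)
  also have "\<dots> \<le> (\<integral>\<^sup>+x. f x \<partial>\<nu>)"
  proof (rule nn_integral_mono_measure)
    show "sets (density L (\<lambda>x. ennreal (u x))) = sets \<nu>" using s by simp
    then show "density L (\<lambda>x. ennreal (u x)) \<le> \<nu>"
      using u by (subst le_measure) (auto simp: is_ac_density_def L_def le_fun_def s)
  qed
  finally show ?thesis by (simp add: L_def)
qed

text \<open>Bounding the interaction from below by a term linear in the density \<open>u\<close>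
  makes the functional local in \<open>u\<close>; minimizing the integrand pointwise then gives the
  scale \<open>e powr (1 / (1 + a))\<close>.\<close>

lemma F_eps_lower:
  fixes \<Omega> :: "(real^'d) set"
  assumes \<Omega>: "bounded \<Omega>" "closed \<Omega>"
    and \<rho>: "integrable (lebesgue_on \<Omega>) \<rho>" "\<And>x. x \<in> \<Omega> \<Longrightarrow> 0 \<le> \<rho> x"
    and pq: "0 < p" "0 < q" and e: "0 < e" and \<nu>: "\<nu> \<in> prob_measures_on \<Omega>"
    and \<theta>: "0 \<le> \<theta>" "ennreal \<theta> \<le> emeasure \<nu> (\<Omega> \<inter> ball x0 r)"
  defines "a \<equiv> p / CARD('d)"
  shows "ennreal (e powr (1 / (1 + a)) * (energy_const a * 2 powr (a / (1 + a)) * \<theta> powr (a / (1 + a))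
      * (\<integral>x. \<rho> x powr (1 / (1 + a)) * max (dist x x0 - r) 0 powr (q * a / (1 + a)) \<partial>lebesgue_on \<Omega>)))
    \<le> F_eps \<Omega> \<rho> p q e \<nu>"
proof -
  have a: "0 < a" using pq by (simp add: a_def)
  have \<Omega>b: "\<Omega> \<in> sets borel" using \<Omega> by simp
  let ?s = "1 / (1 + a)" and ?t = "a / (1 + a)"
  define u where "u = ac_density \<Omega> \<nu>"
  have u: "is_ac_density \<Omega> \<nu> u" unfolding u_def by (rule is_ac_density_ac_density[OF \<Omega>b \<nu>])
  then have um [measurable]: "u \<in> borel_measurable (lebesgue_on \<Omega>)" and u0: "\<And>x. x \<in> \<Omega> \<Longrightarrow> 0 \<le> u x"
    by (auto simp: is_ac_density_def intro: measurable_lebesgue_on)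
  define h where "h x = max (dist x x0 - r) 0 powr q" for x
  have hb: "h \<in> borel_measurable borel" unfolding h_def by measurable
  have hm [measurable]: "h \<in> borel_measurable (restrict_space borel \<Omega>)"
    using hb by (rule measurable_restrict_space1)
  have hL [measurable]: "h \<in> borel_measurable (lebesgue_on \<Omega>)"
    using hb by (intro measurable_lebesgue_on measurable_restrict_space1) simp
  have [measurable]: "\<rho> \<in> borel_measurable (lebesgue_on \<Omega>)" using \<rho>(1) by auto
  define G where "G x = \<rho> x powr ?s * max (dist x x0 - r) 0 powr (q * a / (1 + a))" for x
  have Gh: "G x = \<rho> x powr ?s * h x powr ?t" for x
    by (simp add: G_def h_def powr_powr)
  obtain R where R0: "\<forall>x\<in>\<Omega>. dist x0 x \<le> R"
    using \<Omega>(1) bounded_any_center[of \<Omega> x0] by blast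
  have R: "dist x x0 \<le> R" if "x \<in> \<Omega>" for x
    using R0[rule_format, OF that] by (subst dist_commute)
  have Gi: "integrable (lebesgue_on \<Omega>) G"
    unfolding Gh[abs_def]
  proof (rule integrable_powr_mult)
    show "finite_measure (lebesgue_on \<Omega>)" by (rule finite_measure_lebesgue_on[OF \<Omega>])
    show "\<bar>h x powr ?t\<bar> \<le> (max (R - r) 0 powr q) powr ?t" if "x \<in> space (lebesgue_on \<Omega>)" for x
      using R[of x] that a pq by (auto simp: h_def intro!: powr_mono2)
  qed (use \<rho> a in auto)
  have "ennreal (e powr ?s * (energy_const a * 2 powr ?t * \<theta> powr ?t * integral\<^sup>L (lebesgue_on \<Omega>) G))
      = ennreal (\<integral>x. e powr ?s * (energy_const a * 2 powr ?t * \<theta> powr ?t) * G x \<partial>lebesgue_on \<Omega>)"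
    by (simp add: mult.assoc)
  also have "\<dots> = (\<integral>\<^sup>+x. e powr ?s * (energy_const a * 2 powr ?t * \<theta> powr ?t) * G x \<partial>lebesgue_on \<Omega>)"
  proof (rule nn_integral_eq_integral[symmetric])
    show "AE x in lebesgue_on \<Omega>. 0 \<le> e powr ?s * (energy_const a * 2 powr ?t * \<theta> powr ?t) * G x"
      using energy_const_pos[OF a] by (simp add: G_def)
  qed (use Gi in simp)
  also have "\<dots> = (\<integral>\<^sup>+x. energy_const a * (e * \<rho> x) powr ?s * (2 * \<theta> * h x) powr ?t \<partial>lebesgue_on \<Omega>)"
    using e \<theta> \<rho>(2) by (intro nn_integral_cong) (auto simp: Gh powr_mult h_def mult_ac)
  \<comment> \<open>Pointwise minimization with the weight \<open>w = 2 * \<theta> * h x\<close>,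
    the cost per unit of density at \<open>x\<close> against the mass \<open>\<theta>\<close> in the
    ball.\<close>
  also have "\<dots> \<le> (\<integral>\<^sup>+x. ennreal e * location_integrand a (\<rho> x) (u x) + ennreal (2 * \<theta> * h x * u x) \<partial>lebesgue_on \<Omega>)"
    using a e \<theta> u0 \<rho>(2) by (intro nn_integral_mono location_integrand_lower) (auto simp: h_def)
  also have "\<dots> = ennreal e * (\<integral>\<^sup>+x. location_integrand a (\<rho> x) (u x) \<partial>lebesgue_on \<Omega>)
      + (\<integral>\<^sup>+x. ennreal (2 * \<theta> * h x * u x) \<partial>lebesgue_on \<Omega>)"
    by (simp add: nn_integral_add nn_integral_cmult location_integrand_def)
  also have "(\<integral>\<^sup>+x. ennreal (2 * \<theta> * h x * u x) \<partial>lebesgue_on \<Omega>)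
      = (\<integral>\<^sup>+x. ennreal (2 * \<theta>) * (u x * ennreal (h x)) \<partial>lebesgue_on \<Omega>)"
    using \<theta> u0 by (intro nn_integral_cong) (simp add: h_def mult_ac flip: ennreal_mult)
  also have "\<dots> = ennreal (2 * \<theta>) * (\<integral>\<^sup>+x. u x * ennreal (h x) \<partial>restrict_space lborel \<Omega>)"
    by (simp add: nn_integral_cmult nn_integral_lebesgue_on[OF \<Omega>b, symmetric])
  also have "\<dots> \<le> ennreal (2 * \<theta>) * (\<integral>\<^sup>+x. ennreal (h x) \<partial>\<nu>)"
    by (intro mult_left_mono nn_integral_ac_density_le[OF \<nu> u]) auto
  also have "\<dots> \<le> (\<integral>\<^sup>+z. ennreal (dist (fst z) (snd z) powr q) \<partial>(\<nu> \<Otimes>\<^sub>M \<nu>))"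
    unfolding h_def by (rule interaction_lower[OF \<Omega>b \<nu> pq(2) \<theta>])
  finally show ?thesis
    unfolding F_eps_def a_def[symmetric] u_def[symmetric] G_def[symmetric] by (simp add: add_left_mono)
qed

section \<open>Upper bound\<close>

text \<open>The density of a competitor must be Borel, while \<open>\<rho>\<close> is only Lebesgue
  measurable. The absolute value makes the Borel version nonnegative everywhere, not just almost
  everywhere.\<close>

lemma ex_borel_version:
  fixes \<rho> :: "'a::euclidean_space \<Rightarrow> real"
  assumes \<Omega>: "\<Omega> \<in> sets borel" and \<rho>: "\<rho> \<in> borel_measurable (lebesgue_on \<Omega>)" "\<And>x. x \<in> \<Omega> \<Longrightarrow> 0 \<le> \<rho> x"
  obtains \<rho>' where "\<rho>' \<in> borel_measurable borel" "\<And>x. 0 \<le> \<rho>' x" "AE x in lebesgue_on \<Omega>. \<rho> x = \<rho>' x"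
proof -
  have "(\<lambda>x. indicator \<Omega> x * \<rho> x) \<in> borel_measurable lebesgue"
    using \<rho>(1) \<Omega> by (simp add: borel_measurable_restrict_space_iff)
  then obtain g where g: "g \<in> borel_measurable lborel" "AE x in lborel. indicator \<Omega> x * \<rho> x = g x"
    using completion_ex_borel_measurable_real by blast
  have "AE x in lborel. x \<in> \<Omega> \<longrightarrow> \<rho> x = \<bar>g x\<bar>"
    using g(2) by eventually_elim (metis \<rho>(2) abs_of_nonneg indicator_simps(1) mult_1)
  then have "AE x in lebesgue_on \<Omega>. \<rho> x = \<bar>g x\<bar>"
    unfolding AE_lebesgue_on_iff[OF \<Omega>] using \<Omega> by (simp add: AE_restrict_space_iff)
  moreover have "(\<lambda>x. \<bar>g x\<bar>) \<in> borel_measurable borel" using g(1) by simp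
  ultimately show ?thesis using that by (metis abs_ge_zero)
qed

text \<open>Expand the double integral over the two parts of \<open>\<nu>\<close>. The density
  against itself costs at most \<open>D * m\<^sup>2\<close>, the point mass against itself costs 0,
  and the two cross terms give the factor 2 once \<open>1 - m\<close> is bounded by 1.\<close>

lemma interaction_upper:
  fixes \<Omega> :: "'a::euclidean_space set"
  assumes \<Omega>: "\<Omega> \<in> sets borel" and y: "y \<in> \<Omega>" and q: "0 < q" and m: "0 \<le> m"
    and um: "u \<in> borel_measurable (restrict_space lborel \<Omega>)" and u0: "\<And>x. x \<in> \<Omega> \<Longrightarrow> 0 \<le> u x"
    and um1: "(\<integral>\<^sup>+x. u x \<partial>restrict_space lborel \<Omega>) = ennreal m"
    and D: "\<And>x z. x \<in> \<Omega> \<Longrightarrow> z \<in> \<Omega> \<Longrightarrow> dist x z powr q \<le> D"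
    and \<nu>: "\<nu> \<in> prob_measures_on \<Omega>"
    and int: "\<And>f :: 'a \<Rightarrow> ennreal. f \<in> borel_measurable (restrict_space borel \<Omega>) \<Longrightarrow>
       (\<integral>\<^sup>+x. f x \<partial>\<nu>) = (\<integral>\<^sup>+x. u x * f x \<partial>restrict_space lborel \<Omega>) + ennreal (1 - m) * f y"
  shows "(\<integral>\<^sup>+z. ennreal (dist (fst z) (snd z) powr q) \<partial>(\<nu> \<Otimes>\<^sub>M \<nu>))
    \<le> ennreal (D * m\<^sup>2) + (\<integral>\<^sup>+x. ennreal (2 * dist x y powr q * u x) \<partial>restrict_space lborel \<Omega>)"
proof -
  interpret prob_space \<nu> using \<nu> by (simp add: prob_measures_on_def)
  define B where "B = restrict_space (borel :: 'a measure) \<Omega>"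
  define L where "L = restrict_space (lborel :: 'a measure) \<Omega>"
  have s [measurable_cong]: "sets \<nu> = sets B"
    using \<nu> by (simp add: prob_measures_on_def B_def)
  have sL [measurable_cong]: "sets L = sets B" by (simp add: L_def B_def sets_restrict_space)
  have spB: "space B = \<Omega>" and spL: "space L = \<Omega>" by (auto simp: B_def L_def space_restrict_space)
  have [measurable]: "(\<lambda>x. x) \<in> B \<rightarrow>\<^sub>M borel"
    unfolding B_def by (rule measurable_restrict_space1) simp
  have um' [measurable]: "u \<in> borel_measurable L" using um by (simp add: L_def)
  define c where "c x z = ennreal (dist x z powr q)" for x z :: 'a
  have cm [measurable]: "(\<lambda>(x, z). c x z) \<in> borel_measurable (B \<Otimes>\<^sub>M B)"
    unfolding c_def split_beta' B_def by measurable
  have [measurable]: "c x \<in> borel_measurable B" for x unfolding c_def by measurable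
  have c_commute: "c x z = c z x" for x z by (simp add: c_def dist_commute)
  have cD: "c x z \<le> ennreal D" if "x \<in> \<Omega>" "z \<in> \<Omega>" for x z
    unfolding c_def by (intro ennreal_leI D that)
  have D0: "0 \<le> D" using D[OF y y] q by simp
  \<comment> \<open>The cost of one cross term, before multiplication by the mass
    \<open>1 - m\<close> at \<open>y\<close>.\<close>
  define k where "k = (\<integral>\<^sup>+x. u x * c y x \<partial>L)"
  define g where "g x = (\<integral>\<^sup>+z. c x z \<partial>\<nu>)" for x
  have g [measurable]: "g \<in> borel_measurable B"
    unfolding g_def using cm measurable_cong_sets[OF sets_pair_measure_cong[OF refl s] refl]
    by (intro borel_measurable_nn_integral) auto
  have gy: "g y \<le> k"
  proof -
    have "c y y = 0" using q by (simp add: c_def)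
    then show ?thesis
      unfolding g_def k_def using int[of "c y"] by (simp add: B_def[symmetric] L_def[symmetric])
  qed
  \<comment> \<open>Only the interaction with the density is bounded crudely by \<open>D\<close>;
    its mass is \<open>m\<close>, so after integrating against \<open>u\<close> it contributes at
    second order in \<open>m\<close>.\<close>
  have gx: "g x \<le> ennreal (D * m) + c y x" if x: "x \<in> \<Omega>" for x
  proof -
    have "g x = (\<integral>\<^sup>+z. u z * c x z \<partial>L) + ennreal (1 - m) * c x y"
      unfolding g_def using int[of "c x"] by (simp add: B_def[symmetric] L_def[symmetric])
    also have "\<dots> \<le> (\<integral>\<^sup>+z. ennreal D * u z \<partial>L) + 1 * c x y"
    proof (intro add_mono mult_right_mono nn_integral_mono)
      show "ennreal (u z) * c x z \<le> ennreal D * ennreal (u z)" if "z \<in> space L" for z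
        using cD[OF x, of z] that spL by (subst mult.commute) (auto intro!: mult_right_mono)
      show "ennreal (1 - m) \<le> 1" using m by (simp flip: ennreal_1 add: ennreal_leI del: ennreal_1)
    qed auto
    also have "(\<integral>\<^sup>+z. ennreal D * u z \<partial>L) = ennreal (D * m)"
      using um1 D0 m by (simp add: nn_integral_cmult L_def[symmetric] ennreal_mult)
    finally show ?thesis by (simp add: c_commute)
  qed
  have "(\<integral>\<^sup>+z. ennreal (dist (fst z) (snd z) powr q) \<partial>(\<nu> \<Otimes>\<^sub>M \<nu>)) = (\<integral>\<^sup>+x. g x \<partial>\<nu>)"
    unfolding g_def using nn_integral_fst[of "\<lambda>(x, z). c x z" \<nu>] cm
    by (simp add: c_def[abs_def] split_beta' measurable_cong_sets[OF sets_pair_measure_cong[OF s s] refl])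
  also have "\<dots> = (\<integral>\<^sup>+x. u x * g x \<partial>L) + ennreal (1 - m) * g y"
    using int[of g] g by (simp add: B_def[symmetric] L_def[symmetric])
  also have "\<dots> \<le> (\<integral>\<^sup>+x. ennreal (D * m) * u x + u x * c y x \<partial>L) + 1 * k"
  proof (intro add_mono mult_mono nn_integral_mono)
    show "ennreal (u x) * g x \<le> ennreal (D * m) * ennreal (u x) + ennreal (u x) * c y x" if "x \<in> space L" for x
      using mult_left_mono[OF gx[of x], of "ennreal (u x)"] that spL by (simp add: distrib_left mult.commute)
    show "ennreal (1 - m) \<le> 1" using m by (simp flip: ennreal_1 add: ennreal_leI del: ennreal_1)
  qed (auto simp: gy)
  also have "(\<integral>\<^sup>+x. ennreal (D * m) * u x + u x * c y x \<partial>L) = ennreal (D * m) * ennreal m + k"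
    unfolding k_def using um1 by (simp add: nn_integral_add nn_integral_cmult L_def[symmetric])
  also have "ennreal (D * m) * ennreal m = ennreal (D * m\<^sup>2)"
    using D0 m by (simp add: power2_eq_square mult.assoc flip: ennreal_mult)
  also have "ennreal (D * m\<^sup>2) + k + 1 * k = ennreal (D * m\<^sup>2) + 2 * k"
    by (simp add: mult_2 add.assoc)
  also have "2 * k = (\<integral>\<^sup>+x. 2 * (u x * c y x) \<partial>L)"
    unfolding k_def by (simp add: nn_integral_cmult)
  also have "\<dots> = (\<integral>\<^sup>+x. ennreal (2 * dist x y powr q * u x) \<partial>L)"
    using u0 spL by (intro nn_integral_cong) (simp add: c_def dist_commute[of y] ennreal_mult mult_ac)
  finally show ?thesis by (simp add: L_def)
qed

lemma integrable_lebesgue_on_iff: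
  fixes f :: "'a::euclidean_space \<Rightarrow> real"
  assumes \<Omega>: "\<Omega> \<in> sets borel" and f: "f \<in> borel_measurable (restrict_space lborel \<Omega>)"
  shows "integrable (lebesgue_on \<Omega>) f \<longleftrightarrow> integrable (restrict_space lborel \<Omega>) f"
  using f measurable_lebesgue_on[OF f] by (simp add: integrable_iff_bounded nn_integral_lebesgue_on[OF \<Omega>])

text \<open>
  The cut-off \<open>\<delta>\<close> is needed because the optimal density for the weight \<open>|x - y|\<^sup>q\<close> need not be
  integrable near \<open>y\<close>.
\<close>

lemma F_eps_upper:
  fixes \<Omega> :: "(real^'d) set"
  assumes \<Omega>: "bounded \<Omega>" "closed \<Omega>"
    and \<rho>: "integrable (lebesgue_on \<Omega>) \<rho>" "\<And>x. x \<in> \<Omega> \<Longrightarrow> 0 \<le> \<rho> x"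
    and pq: "0 < p" "0 < q" and y: "y \<in> \<Omega>" and \<delta>: "0 < \<delta>"
  defines "a \<equiv> p / CARD('d)"
  obtains M D where "0 \<le> D" "\<And>e. 0 < e \<Longrightarrow> e powr (1 / (1 + a)) * M \<le> 1 \<Longrightarrow> \<exists>\<nu>\<in>prob_measures_on \<Omega>.
    F_eps \<Omega> \<rho> p q e \<nu> \<le> ennreal (e powr (1 / (1 + a)) * (energy_const a * 2 powr (a / (1 + a))
      * (\<integral>x. \<rho> x powr (1 / (1 + a)) * max (dist x y) \<delta> powr (q * a / (1 + a)) \<partial>lebesgue_on \<Omega>))
      + D * (e powr (1 / (1 + a)) * M)\<^sup>2)"
proof -
  have a: "0 < a" using pq by (simp add: a_def)
  let ?s = "1 / (1 + a)" and ?t = "a / (1 + a)"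
  have s: "0 \<le> ?s" "?s \<le> 1" using a by (simp_all add: field_simps)
  have \<Omega>b: "\<Omega> \<in> sets borel" using \<Omega> by simp
  define L where "L = restrict_space (lborel :: (real^'d) measure) \<Omega>"
  have spL: "space L = \<Omega>" by (simp add: L_def space_restrict_space)
  interpret fin: finite_measure "lebesgue_on \<Omega>" by (rule finite_measure_lebesgue_on[OF \<Omega>])
  have finL: "finite_measure L"
    using fin.emeasure_finite[of \<Omega>] \<Omega>b
    by (intro finite_measureI) (simp add: spL L_def emeasure_restrict_space)
  define D where "D = diameter \<Omega> powr q"
  have D: "dist x z powr q \<le> D" if "x \<in> \<Omega>" "z \<in> \<Omega>" for x z
    unfolding D_def using diameter_bounded_bound[OF \<Omega>(1) that] pq by (intro powr_mono2) auto
  obtain \<rho>' where \<rho>': "\<rho>' \<in> borel_measurable borel" "\<And>x. 0 \<le> \<rho>' x" "AE x in lebesgue_on \<Omega>. \<rho> x = \<rho>' x"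
    by (rule ex_borel_version[OF \<Omega>b borel_measurable_integrable[OF \<rho>(1)] \<rho>(2)]) (assumption, rule that)
  have borel_L: "f \<in> borel_measurable L" if "f \<in> borel_measurable borel" for f :: "real^'d \<Rightarrow> real"
    unfolding L_def using that by (intro measurable_restrict_space1) simp
  have [measurable]: "\<rho>' \<in> borel_measurable L" by (rule borel_L[OF \<rho>'(1)])
  have \<rho>'L: "\<rho>' \<in> borel_measurable (lebesgue_on \<Omega>)"
    using borel_L[OF \<rho>'(1)] unfolding L_def by (rule measurable_lebesgue_on)
  have "integrable (lebesgue_on \<Omega>) \<rho>'"
    using integrable_cong_AE[of \<rho> "lebesgue_on \<Omega>" \<rho>'] \<rho>(1) \<rho>'(3) \<rho>'L by auto
  then have \<rho>'i: "integrable L \<rho>'"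
    using integrable_lebesgue_on_iff[OF \<Omega>b] borel_L[OF \<rho>'(1)] by (simp add: L_def)
  \<comment> \<open>The weight of the cross terms, cut off below distance \<open>\<delta>\<close>.
    It is bounded below by \<open>2 * \<delta> powr q\<close>, which keeps the optimal density
    integrable.\<close>
  define w where "w x = 2 * max (dist x y) \<delta> powr q" for x
  have wm [measurable]: "w \<in> borel_measurable L" unfolding w_def by (rule borel_L) measurable
  have w\<delta>: "2 * \<delta> powr q \<le> w x" for x
    unfolding w_def using \<delta> pq by (auto intro!: powr_mono2)
  have w0: "0 < w x" for x using w\<delta>[of x] \<delta> by (smt (verit) powr_gt_zero)
  \<comment> \<open>The optimal density with its dependence on \<open>e\<close> factored out. A
    competitor then has density \<open>e powr ?s * v x\<close> and mass
    \<open>e powr ?s * M\<close>, which explains the smallness condition on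
    \<open>e\<close>.\<close>
  define v where "v x = \<rho>' x powr ?s * (a / w x) powr ?s" for x
  have vi: "integrable L v"
    unfolding v_def
  proof (rule integrable_powr_mult[OF \<rho>'i \<rho>'(2) finL s])
    show "\<bar>(a / w x) powr ?s\<bar> \<le> (a / (2 * \<delta> powr q)) powr ?s" for x
      using w\<delta>[of x] w0[of x] a \<delta> by (auto intro!: powr_mono2 divide_left_mono)
  qed measurable
  have v0: "0 \<le> v x" for x by (simp add: v_def)
  define M where "M = integral\<^sup>L L v"
  have M0: "0 \<le> M" unfolding M_def using v0 by simp
  define G where "G x = \<rho> x powr ?s * max (dist x y) \<delta> powr (q * a / (1 + a))" for x
  have Gw: "2 powr ?t * G x = \<rho> x powr ?s * w x powr ?t" for x
    by (simp add: G_def w_def powr_mult powr_powr)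
  have Gi: "integrable (lebesgue_on \<Omega>) G"
    unfolding G_def
  proof (rule integrable_powr_mult[OF \<rho>(1) _ fin.finite_measure_axioms s])
    show "(\<lambda>x. max (dist x y) \<delta> powr (q * a / (1 + a))) \<in> borel_measurable (lebesgue_on \<Omega>)"
      by (intro measurable_lebesgue_on borel_L[unfolded L_def]) measurable
    show "\<bar>max (dist x y) \<delta> powr (q * a / (1 + a))\<bar> \<le> max (diameter \<Omega>) \<delta> powr (q * a / (1 + a))"
      if "x \<in> space (lebesgue_on \<Omega>)" for x
      using that diameter_bounded_bound[OF \<Omega>(1) _ y, of x] pq a \<delta> by (auto intro!: powr_mono2)
  qed (use \<rho>(2) in simp)
  have "\<exists>\<nu>\<in>prob_measures_on \<Omega>. F_eps \<Omega> \<rho> p q e \<nu>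
      \<le> ennreal (e powr ?s * (energy_const a * 2 powr ?t * integral\<^sup>L (lebesgue_on \<Omega>) G) + D * (e powr ?s * M)\<^sup>2)"
    if e: "0 < e" and small: "e powr ?s * M \<le> 1" for e
  proof -
    \<comment> \<open>The pointwise minimizer for \<open>w\<close>, written with the Borel version
      \<open>\<rho>'\<close> so that it is an admissible density.\<close>
    define u where "u x = (a * (e * \<rho>' x) / w x) powr ?s" for x
    have uv: "u x = e powr ?s * v x" for x
      using a e w0[of x] \<rho>'(2)[of x] by (simp add: u_def v_def powr_divide powr_mult)
    have um: "u \<in> borel_measurable L" unfolding u_def by measurable
    have u0: "0 \<le> u x" for x by (simp add: u_def)
    define m where "m = e powr ?s * M"
    have m: "0 \<le> m" "m \<le> 1" using small M0 by (auto simp: m_def)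
    have int_u: "(\<integral>\<^sup>+x. u x \<partial>L) = ennreal m"
      unfolding uv m_def M_def using vi v0 by (subst nn_integral_eq_integral) auto
    obtain \<nu> where \<nu>: "\<nu> \<in> prob_measures_on \<Omega>" "is_ac_density \<Omega> \<nu> u"
      "\<And>f :: real^'d \<Rightarrow> ennreal. f \<in> borel_measurable (restrict_space borel \<Omega>) \<Longrightarrow>
         (\<integral>\<^sup>+x. f x \<partial>\<nu>) = (\<integral>\<^sup>+x. u x * f x \<partial>L) + ennreal (1 - m) * f y"
      using ex_density_add_dirac[OF \<Omega>b y um[unfolded L_def] u0 int_u[unfolded L_def] m]
      unfolding L_def by metis
    \<comment> \<open>The chosen \<open>ac_density\<close> is determined only up to null sets, which
      is enough inside the integral.\<close>
    have ac: "AE x in lebesgue_on \<Omega>. ac_density \<Omega> \<nu> x = u x"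
      unfolding AE_lebesgue_on_iff[OF \<Omega>b]
      by (rule is_ac_density_unique[OF \<Omega>b \<nu>(1) is_ac_density_ac_density[OF \<Omega>b \<nu>(1)] \<nu>(2)])
    have loc: "(\<integral>\<^sup>+x. location_integrand a (\<rho> x) (ac_density \<Omega> \<nu> x) \<partial>lebesgue_on \<Omega>)
        = (\<integral>\<^sup>+x. location_integrand a (\<rho>' x) (u x) \<partial>L)"
      unfolding L_def nn_integral_lebesgue_on[OF \<Omega>b, symmetric]
      using ac \<rho>'(3) by (intro nn_integral_cong_AE) (auto elim: eventually_elim2)
    have "(\<integral>\<^sup>+z. ennreal (dist (fst z) (snd z) powr q) \<partial>(\<nu> \<Otimes>\<^sub>M \<nu>))
        \<le> ennreal (D * m\<^sup>2) + (\<integral>\<^sup>+x. ennreal (2 * dist x y powr q * u x) \<partial>L)"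
      using interaction_upper[OF \<Omega>b y pq(2) m(1) um[unfolded L_def] u0 int_u[unfolded L_def] D \<nu>(1)] \<nu>(3)
      by (simp add: L_def)
    \<comment> \<open>Replacing the true distance by its cut-off can only increase the interaction;
      afterwards the integrand is exactly the one minimized by \<open>u\<close>.\<close>
    also have "\<dots> \<le> ennreal (D * m\<^sup>2) + (\<integral>\<^sup>+x. ennreal (w x * u x) \<partial>L)"
      using u0 pq by (intro add_left_mono nn_integral_mono ennreal_leI mult_right_mono)
        (auto simp: w_def intro!: powr_mono2)
    finally have "F_eps \<Omega> \<rho> p q e \<nu> \<le> ennreal e * (\<integral>\<^sup>+x. location_integrand a (\<rho>' x) (u x) \<partial>L)
        + (ennreal (D * m\<^sup>2) + (\<integral>\<^sup>+x. ennreal (w x * u x) \<partial>L))"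
      unfolding F_eps_def a_def[symmetric] loc by (rule add_left_mono)
    also have "\<dots> = ennreal (D * m\<^sup>2)
        + (\<integral>\<^sup>+x. ennreal e * location_integrand a (\<rho>' x) (u x) + ennreal (w x * u x) \<partial>L)"
      using um by (simp add: nn_integral_add nn_integral_cmult location_integrand_def add_ac)
    also have "(\<integral>\<^sup>+x. ennreal e * location_integrand a (\<rho>' x) (u x) + ennreal (w x * u x) \<partial>L)
        = (\<integral>\<^sup>+x. ennreal (energy_const a * (e * \<rho>' x) powr ?s * w x powr ?t) \<partial>L)"
      unfolding u_def using a e \<rho>'(2) w0 by (intro nn_integral_cong location_integrand_optimal)
    also have "\<dots> = (\<integral>\<^sup>+x. ennreal (e powr ?s * (energy_const a * 2 powr ?t) * G x) \<partial>lebesgue_on \<Omega>)"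
      unfolding L_def nn_integral_lebesgue_on[OF \<Omega>b, symmetric]
    proof (rule nn_integral_cong_AE)
      show "AE x in lebesgue_on \<Omega>. ennreal (energy_const a * (e * \<rho>' x) powr ?s * w x powr ?t)
          = ennreal (e powr ?s * (energy_const a * 2 powr ?t) * G x)"
        using \<rho>'(3)
      proof eventually_elim
        case (elim x)
        then show ?case
          using Gw[of x] e \<rho>'(2)[of x] by (simp add: powr_mult mult.assoc mult.left_commute)
      qed
    qed
    also have "\<dots> = ennreal (\<integral>x. e powr ?s * (energy_const a * 2 powr ?t) * G x \<partial>lebesgue_on \<Omega>)"
    proof (rule nn_integral_eq_integral)
      show "AE x in lebesgue_on \<Omega>. 0 \<le> e powr ?s * (energy_const a * 2 powr ?t) * G x"
        using energy_const_pos[OF a] by (simp add: G_def)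
    qed (use Gi in simp)
    also have "(\<integral>x. e powr ?s * (energy_const a * 2 powr ?t) * G x \<partial>lebesgue_on \<Omega>)
        = e powr ?s * (energy_const a * 2 powr ?t * integral\<^sup>L (lebesgue_on \<Omega>) G)"
      by (simp add: mult.assoc)
    also have "ennreal (D * m\<^sup>2) + ennreal (e powr ?s * (energy_const a * 2 powr ?t * integral\<^sup>L (lebesgue_on \<Omega>) G))
        = ennreal (e powr ?s * (energy_const a * 2 powr ?t * integral\<^sup>L (lebesgue_on \<Omega>) G) + D * m\<^sup>2)"
      using energy_const_pos[OF a]
      by (subst ennreal_plus[symmetric]) (auto simp: D_def G_def add.commute intro!: mult_nonneg_nonneg)
    finally show ?thesis using \<nu>(1) by (auto simp: m_def)
  qed
  then show ?thesis using that[of D M] unfolding G_def by (simp add: D_def)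
qed

section \<open>Concentration of the minimizers\<close>

text \<open>Otherwise \<open>g\<close> exceeds its mean by more than \<open>\<eta>\<close>
  everywhere. This makes the mean finite, and integrating gives mean plus \<open>\<eta>\<close> at
  most the mean, a contradiction.\<close>

lemma (in prob_space) ex_le_nn_integral:
  assumes g: "g \<in> borel_measurable M" and \<eta>: "0 < \<eta>"
  shows "\<exists>x\<in>space M. g x \<le> (\<integral>\<^sup>+x. g x \<partial>M) + ennreal \<eta>"
proof (rule ccontr)
  assume "\<not> ?thesis"
  then have less: "(\<integral>\<^sup>+x. g x \<partial>M) + ennreal \<eta> < g x" if "x \<in> space M" for x
    using that by (auto simp: not_le)
  obtain x where "x \<in> space M" using not_empty by blast
  with less have fin: "(\<integral>\<^sup>+x. g x \<partial>M) < \<top>" by (metis ennreal_add_eq_top less_top not_less_iff_gr_or_eq top.not_eq_extremum order_less_trans)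
  have "(\<integral>\<^sup>+x. g x \<partial>M) + ennreal \<eta> = (\<integral>\<^sup>+_. (\<integral>\<^sup>+x. g x \<partial>M) + ennreal \<eta> \<partial>M)"
    by (simp add: emeasure_space_1)
  also have "\<dots> \<le> (\<integral>\<^sup>+x. g x \<partial>M)"
    using less by (intro nn_integral_mono) (simp add: less_imp_le)
  finally show False using fin \<eta> by (metis add.right_neutral ennreal_add_left_cancel_le ennreal_le_epsilon leD less_top ennreal_0 ennreal_eq_0_iff le_zero_eq)
qed

text \<open>One of the two legs is at least half of \<open>dist x z\<close>. This crude form covers
  \<open>q < 1\<close> and \<open>q \<ge> 1\<close> alike.\<close>

lemma dist_powr_triangle:
  fixes x y z :: "'a::metric_space"
  assumes "0 < q"
  shows "dist x z powr q \<le> 2 powr q * (dist x y powr q + dist y z powr q)"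
proof -
  have "dist x z powr q \<le> (2 * max (dist x y) (dist y z)) powr q"
    using assms dist_triangle[of x z y] by (intro powr_mono2) auto
  also have "\<dots> = 2 powr q * max (dist x y) (dist y z) powr q"
    by (rule powr_mult)
  also have "\<dots> \<le> 2 powr q * (dist x y powr q + dist y z powr q)"
    by (intro mult_left_mono) (auto simp: max_def)
  finally show ?thesis .
qed

lemma prob_measure_eq_return:
  fixes \<Omega> :: "'a::euclidean_space set"
  assumes \<mu>: "\<mu> \<in> prob_measures_on \<Omega>" and x0: "x0 \<in> \<Omega>" and AE: "AE x in \<mu>. x = x0"
  shows "\<mu> = return (restrict_space borel \<Omega>) x0"
proof (rule measure_eqI)
  interpret prob_space \<mu> using \<mu> by (simp add: prob_measures_on_def)
  show s: "sets \<mu> = sets (return (restrict_space borel \<Omega>) x0)"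
    using \<mu> by (simp add: prob_measures_on_def)
  fix A assume A: "A \<in> sets \<mu>"
  have "emeasure \<mu> A = (\<integral>\<^sup>+x. indicator A x \<partial>\<mu>)" using A by simp
  also have "\<dots> = (\<integral>\<^sup>+x. indicator A x0 \<partial>\<mu>)"
    by (rule nn_integral_cong_AE) (use AE in eventually_elim, simp)
  also have "\<dots> = indicator A x0" by (simp add: emeasure_space_1)
  finally show "emeasure \<mu> A = emeasure (return (restrict_space borel \<Omega>) x0) A"
    using A s by (simp add: emeasure_return)
qed

lemma integrable_dist_powr:
  fixes \<Omega> :: "'a::euclidean_space set"
  assumes \<Omega>: "bounded \<Omega>" and \<nu>: "\<nu> \<in> prob_measures_on \<Omega>" and y: "y \<in> \<Omega>" and q: "0 < q"
  shows "integrable \<nu> (\<lambda>x. dist x y powr q)"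
proof -
  interpret prob_space \<nu> using \<nu> by (simp add: prob_measures_on_def)
  have s: "sets \<nu> = sets (restrict_space borel \<Omega>)"
    using \<nu> by (simp add: prob_measures_on_def)
  have sp: "space \<nu> = \<Omega>" using sets_eq_imp_space_eq[OF s] by (simp add: space_restrict_space)
  have "(\<lambda>x. dist x y powr q) \<in> borel_measurable \<nu>"
    unfolding measurable_cong_sets[OF s refl] by (rule measurable_restrict_space1) measurable
  moreover have "dist x y powr q \<le> diameter \<Omega> powr q" if "x \<in> \<Omega>" for x
    using diameter_bounded_bound[OF \<Omega> that y] q by (intro powr_mono2) auto
  ultimately show ?thesis
    by (intro integrable_const_bound[of _ "diameter \<Omega> powr q"]) (auto simp: sp)
qed

text \<open>Small energy gives centres about which the \<open>\<mu>s n\<close> have small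
  \<open>q\<close>-th moments. Compactness makes a subsequence of the centres converge to
  \<open>x0\<close>, and the weak* limit then has zero moment about \<open>x0\<close>.\<close>

lemma weak_star_concentration:
  fixes \<Omega> :: "'a::euclidean_space set"
  assumes \<Omega>: "compact \<Omega>" and q: "0 < q"
    and \<mu>s: "\<And>n. \<mu>s n \<in> prob_measures_on \<Omega>" and \<mu>: "\<mu> \<in> prob_measures_on \<Omega>"
    and conv: "weak_star_tendsto \<Omega> \<mu>s \<mu>"
    and E: "(\<lambda>n. \<integral>\<^sup>+z. ennreal (dist (fst z) (snd z) powr q) \<partial>(\<mu>s n \<Otimes>\<^sub>M \<mu>s n)) \<longlonglongrightarrow> 0"
  obtains x0 where "x0 \<in> \<Omega>" "\<mu> = return (restrict_space borel \<Omega>) x0"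
    "(\<lambda>n. \<integral>x. dist x x0 powr q \<partial>\<mu>s n) \<longlonglongrightarrow> 0"
proof -
  define B where "B = restrict_space (borel :: 'a measure) \<Omega>"
  have sB: "sets \<nu> = sets B" and ps: "prob_space \<nu>" if "\<nu> \<in> prob_measures_on \<Omega>" for \<nu>
    using that by (auto simp: prob_measures_on_def B_def)
  have sp: "space \<nu> = \<Omega>" if "\<nu> \<in> prob_measures_on \<Omega>" for \<nu>
    using sets_eq_imp_space_eq[OF sB[OF that]] by (simp add: B_def space_restrict_space)
  have [measurable]: "(\<lambda>x. x) \<in> B \<rightarrow>\<^sub>M borel"
    unfolding B_def by (rule measurable_restrict_space1) simp
  have dm: "(\<lambda>x. dist x y powr q) \<in> borel_measurable \<nu>" if "\<nu> \<in> prob_measures_on \<Omega>" for \<nu> y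
    unfolding measurable_cong_sets[OF sB[OF that] refl] by measurable
  note di = integrable_dist_powr[OF compact_imp_bounded[OF \<Omega>] _ _ q]
  define En where "En n = (\<integral>\<^sup>+z. ennreal (dist (fst z) (snd z) powr q) \<partial>(\<mu>s n \<Otimes>\<^sub>M \<mu>s n))" for n
  define \<eta> where "\<eta> n = inverse (real (Suc n))" for n
  define bound where "bound n = En n + ennreal (\<eta> n)" for n
  \<comment> \<open>By Tonelli, \<open>En n\<close> is the average over \<open>x\<close> of the
    inner integral, so some centre does no worse than this average plus the vanishing slack
    \<open>\<eta> n\<close>.\<close>
  have "\<exists>x\<in>\<Omega>. (\<integral>\<^sup>+z. dist x z powr q \<partial>\<mu>s n) \<le> bound n" for n
  proof -
    interpret prob_space "\<mu>s n" by (rule ps[OF \<mu>s])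
    have c: "(\<lambda>z. ennreal (dist (fst z) (snd z) powr q)) \<in> borel_measurable (\<mu>s n \<Otimes>\<^sub>M \<mu>s n)"
      unfolding measurable_cong_sets[OF sets_pair_measure_cong[OF sB[OF \<mu>s] sB[OF \<mu>s]] refl]
      unfolding B_def by measurable
    have "(\<lambda>x. \<integral>\<^sup>+z. dist x z powr q \<partial>\<mu>s n) \<in> borel_measurable (\<mu>s n)"
      using borel_measurable_nn_integral_fst[OF c] by simp
    from ex_le_nn_integral[OF this, of "\<eta> n"] nn_integral_fst[OF c] show ?thesis
      by (auto simp: sp[OF \<mu>s] bound_def En_def \<eta>_def)
  qed
  then obtain x where x: "\<And>n. x n \<in> \<Omega>" "\<And>n. (\<integral>\<^sup>+z. dist (x n) z powr q \<partial>\<mu>s n) \<le> bound n"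
    by metis
  from \<Omega> x(1) obtain x0 r where x0: "x0 \<in> \<Omega>" and r: "strict_mono r" "(x \<circ> r) \<longlonglongrightarrow> x0"
    unfolding compact_def by metis
  define I where "I n = (\<integral>z. dist z x0 powr q \<partial>\<mu>s n)" for n
  have I_nn: "ennreal (I n) = (\<integral>\<^sup>+z. dist z x0 powr q \<partial>\<mu>s n)" for n
    unfolding I_def by (rule nn_integral_eq_integral[symmetric]) (use di[OF \<mu>s x0] in auto)
  have I_le: "ennreal (I n) \<le> ennreal (2 powr q) * (bound n + ennreal (dist (x n) x0 powr q))" for n
  proof -
    interpret prob_space "\<mu>s n" by (rule ps[OF \<mu>s])
    have "ennreal (I n) \<le> (\<integral>\<^sup>+z. ennreal (2 powr q) * (ennreal (dist z (x n) powr q) + ennreal (dist (x n) x0 powr q)) \<partial>\<mu>s n)"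
      unfolding I_nn using dist_powr_triangle[OF q]
      by (intro nn_integral_mono) (simp flip: ennreal_plus ennreal_mult add: ennreal_leI)
    also have "\<dots> = ennreal (2 powr q) * ((\<integral>\<^sup>+z. dist z (x n) powr q \<partial>\<mu>s n) + ennreal (dist (x n) x0 powr q))"
      using dm[OF \<mu>s] by (simp add: nn_integral_cmult nn_integral_add emeasure_space_1)
    also have "\<dots> \<le> ennreal (2 powr q) * (bound n + ennreal (dist (x n) x0 powr q))"
      using x(2)[of n] by (intro mult_left_mono add_right_mono) (auto simp: dist_commute)
    finally show ?thesis .
  qed
  have bound: "bound \<longlonglongrightarrow> 0"
    unfolding bound_def[abs_def]
    using tendsto_add[OF E tendsto_ennrealI[OF LIMSEQ_inverse_real_of_nat]] by (simp add: En_def \<eta>_def)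
  have "(\<lambda>k. dist ((x \<circ> r) k) x0 powr q) \<longlonglongrightarrow> 0 powr q"
    using q tendsto_dist[OF r(2) tendsto_const[of x0]] by (intro tendsto_powr2) auto
  then have d: "(\<lambda>k. ennreal (dist (x (r k)) x0 powr q)) \<longlonglongrightarrow> 0"
    using tendsto_ennrealI by fastforce
  have "(\<lambda>k. ennreal (2 powr q) * (bound (r k) + ennreal (dist (x (r k)) x0 powr q))) \<longlonglongrightarrow> ennreal (2 powr q) * (0 + 0)"
    using LIMSEQ_subseq_LIMSEQ[OF bound r(1)] d
    by (intro ennreal_tendsto_cmult tendsto_add) (auto simp: o_def)
  then have up: "(\<lambda>k. ennreal (2 powr q) * (bound (r k) + ennreal (dist (x (r k)) x0 powr q))) \<longlonglongrightarrow> 0"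
    by simp
  have "(\<lambda>k. ennreal (I (r k))) \<longlonglongrightarrow> 0"
    by (rule tendsto_sandwich[OF always_eventually always_eventually tendsto_const up]) (simp_all add: I_le)
  then have "(\<lambda>k. ennreal (I (r k))) \<longlonglongrightarrow> ennreal 0" by simp
  then have I_r: "(\<lambda>k. I (r k)) \<longlonglongrightarrow> 0"
    by (rule tendsto_ennrealD) (auto simp: I_def)
  \<comment> \<open>So far the moments tend to zero only along \<open>r\<close>. Testing weak*
    convergence with this function shows that the whole sequence converges, so the limit along
    \<open>r\<close> is its limit.\<close>
  have "continuous_on \<Omega> (\<lambda>z. dist z x0 powr q)"
    using q by (intro continuous_on_powr' continuous_intros) auto
  with conv have "I \<longlonglongrightarrow> (\<integral>z. dist z x0 powr q \<partial>\<mu>)"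
    by (simp add: weak_star_tendsto_def I_def[abs_def])
  moreover from LIMSEQ_subseq_LIMSEQ[OF this r(1)] I_r have z: "(\<integral>z. dist z x0 powr q \<partial>\<mu>) = 0"
    by (auto simp: o_def intro: LIMSEQ_unique)
  ultimately have "I \<longlonglongrightarrow> 0" by simp
  moreover from z have "AE z in \<mu>. dist z x0 powr q = 0"
    using integral_nonneg_eq_0_iff_AE[OF di[OF \<mu> x0]] by simp
  then have "AE z in \<mu>. z = x0" by simp
  ultimately show ?thesis
    using that[OF x0 prob_measure_eq_return[OF \<mu> x0]] by (simp add: I_def[abs_def])
qed

text \<open>Markov's inequality for the \<open>q\<close>-th moment, applied to the complement of the
  ball.\<close>

lemma emeasure_ball_lower:
  fixes \<Omega> :: "'a::euclidean_space set"
  assumes \<Omega>: "\<Omega> \<in> sets borel" and \<nu>: "\<nu> \<in> prob_measures_on \<Omega>" and q: "0 < q" and r: "0 < r"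
    and int: "integrable \<nu> (\<lambda>x. dist x x0 powr q)"
  shows "ennreal (1 - (\<integral>x. dist x x0 powr q \<partial>\<nu>) / r powr q) \<le> emeasure \<nu> (\<Omega> \<inter> ball x0 r)"
proof -
  interpret prob_space \<nu> using \<nu> by (simp add: prob_measures_on_def)
  have s: "sets \<nu> = sets (restrict_space borel \<Omega>)"
    using \<nu> by (simp add: prob_measures_on_def)
  have sp: "space \<nu> = \<Omega>" using sets_eq_imp_space_eq[OF s] by (simp add: space_restrict_space)
  have B: "\<Omega> \<inter> ball x0 r \<in> sets \<nu>" using s \<Omega> by (auto simp: sets_restrict_space)
  have "prob {x \<in> space \<nu>. r powr q \<le> dist x x0 powr q} \<le> (\<integral>x. dist x x0 powr q \<partial>\<nu>) / r powr q"
    using r by (intro integral_Markov_inequality_measure[OF int]) auto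
  moreover have "space \<nu> - \<Omega> \<inter> ball x0 r \<subseteq> {x \<in> space \<nu>. r powr q \<le> dist x x0 powr q}"
    using r q by (auto simp: sp dist_commute intro!: powr_mono2)
  then have "prob (space \<nu> - \<Omega> \<inter> ball x0 r) \<le> prob {x \<in> space \<nu>. r powr q \<le> dist x x0 powr q}"
    by (rule finite_measure_mono) (rule borel_measurable_le[OF borel_measurable_const borel_measurable_integrable[OF int]])
  ultimately have "1 - prob (\<Omega> \<inter> ball x0 r) \<le> (\<integral>x. dist x x0 powr q \<partial>\<nu>) / r powr q"
    using prob_compl[OF B] by simp
  then show ?thesis unfolding emeasure_eq_measure by (intro ennreal_leI) linarith
qed

section \<open>The limit problem\<close>

text \<open>Dominated convergence with majorant \<open>\<rho> x powr s * \<bar>K\<bar>\<close>. It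
  serves to remove the radius \<open>r\<close> and the cut-off \<open>\<delta>\<close> from the two
  bounds.\<close>

lemma integral_powr_mult_tendsto:
  fixes \<rho> :: "'a::euclidean_space \<Rightarrow> real"
  assumes \<Omega>: "bounded \<Omega>" "closed \<Omega>"
    and \<rho>: "integrable (lebesgue_on \<Omega>) \<rho>" "\<And>x. x \<in> \<Omega> \<Longrightarrow> 0 \<le> \<rho> x"
    and s: "0 \<le> s" "s \<le> 1"
    and meas: "\<And>k. \<phi> k \<in> borel_measurable borel" "\<psi> \<in> borel_measurable borel"
    and lim: "\<And>x. x \<in> \<Omega> \<Longrightarrow> (\<lambda>k. \<phi> k x) \<longlonglongrightarrow> \<psi> x"
    and bd: "\<And>k x. x \<in> \<Omega> \<Longrightarrow> \<bar>\<phi> k x\<bar> \<le> K"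
  shows "(\<lambda>k. \<integral>x. \<rho> x powr s * \<phi> k x \<partial>lebesgue_on \<Omega>) \<longlonglongrightarrow> (\<integral>x. \<rho> x powr s * \<psi> x \<partial>lebesgue_on \<Omega>)"
proof (rule integral_dominated_convergence)
  have m: "f \<in> borel_measurable (lebesgue_on \<Omega>)" if "f \<in> borel_measurable borel" for f :: "'a \<Rightarrow> real"
    using that by (intro measurable_lebesgue_on measurable_restrict_space1) simp
  have [measurable]: "\<psi> \<in> borel_measurable (lebesgue_on \<Omega>)" "\<phi> k \<in> borel_measurable (lebesgue_on \<Omega>)" for k
    using meas by (auto intro: m)
  have [measurable]: "\<rho> \<in> borel_measurable (lebesgue_on \<Omega>)" using \<rho>(1) by auto
  show "(\<lambda>x. \<rho> x powr s * \<psi> x) \<in> borel_measurable (lebesgue_on \<Omega>)"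
    by measurable
  show "(\<lambda>x. \<rho> x powr s * \<phi> k x) \<in> borel_measurable (lebesgue_on \<Omega>)" for k
    by measurable
  show "integrable (lebesgue_on \<Omega>) (\<lambda>x. \<rho> x powr s * \<bar>K\<bar>)"
    by (rule integrable_powr_mult[OF \<rho>(1) _ finite_measure_lebesgue_on[OF \<Omega>] s, where B = "\<bar>K\<bar>"])
      (use \<rho>(2) in auto)
  show "AE x in lebesgue_on \<Omega>. (\<lambda>k. \<rho> x powr s * \<phi> k x) \<longlonglongrightarrow> \<rho> x powr s * \<psi> x"
    using lim by (intro AE_I2 tendsto_mult_left) simp
  show "AE x in lebesgue_on \<Omega>. norm (\<rho> x powr s * \<phi> k x) \<le> \<rho> x powr s * \<bar>K\<bar>" for k
  proof (rule AE_I2)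
    fix x assume "x \<in> space (lebesgue_on \<Omega>)"
    then have "\<bar>\<phi> k x\<bar> \<le> \<bar>K\<bar>" using bd[of x k] by simp
    then show "norm (\<rho> x powr s * \<phi> k x) \<le> \<rho> x powr s * \<bar>K\<bar>"
      by (simp add: abs_mult mult_left_mono)
  qed
qed

theorem mainTheorem2:
  fixes \<Omega> :: "(real^'d) set" and \<rho> :: "real^'d \<Rightarrow> real" and p q :: real
    and \<mu>\<epsilon> :: "real \<Rightarrow> (real^'d) measure" and \<mu> :: "(real^'d) measure"
    and \<epsilon> :: "nat \<Rightarrow> real"
  assumes "bounded \<Omega>" and "closed \<Omega>"
    and "integrable (lebesgue_on \<Omega>) \<rho>" and "\<And>x. x \<in> \<Omega> \<Longrightarrow> 0 \<le> \<rho> x"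
    and "p > 0" and "q > 0"
    and "\<And>e. e > 0 \<Longrightarrow>
           is_arg_min (F_eps \<Omega> \<rho> p q e) (\<lambda>\<nu>. \<nu> \<in> prob_measures_on \<Omega>) (\<mu>\<epsilon> e)"
    and "\<And>n. \<epsilon> n > 0" and "\<epsilon> \<longlonglongrightarrow> 0"
    and "\<mu> \<in> prob_measures_on \<Omega>"
    and "weak_star_tendsto \<Omega> (\<lambda>n. \<mu>\<epsilon> (\<epsilon> n)) \<mu>"
  shows "\<exists>x0\<in>\<Omega>. \<mu> = return (restrict_space borel \<Omega>) x0 \<and>
           is_arg_min (limit_cost \<Omega> \<rho> p q) (\<lambda>x. x \<in> \<Omega>) x0"
proof -
  note \<Omega> = assms(1,2) and \<rho> = assms(3,4) and pq = assms(5,6) and \<mu> = assms(10)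
  have \<Omega>b: "\<Omega> \<in> sets borel" and comp: "compact \<Omega>"
    using \<Omega> by (auto simp: compact_eq_bounded_closed)
  define a s t b where "a = p / CARD('d)" and "s = 1 / (1 + a)" and "t = a / (1 + a)"
    and "b = q * a / (1 + a)"
  have a: "0 < a" using pq by (simp add: a_def)
  have s: "0 < s" "s \<le> 1" and t: "0 < t" and b: "0 < b"
    using a pq by (simp_all add: s_def t_def b_def field_simps)
  \<comment> \<open>The constant common to the lower and the upper bound; it cancels in the
    comparison.\<close>
  define c where "c = energy_const a * 2 powr t"
  have c: "0 < c" using energy_const_pos[OF a] by (simp add: c_def)
  define J where "J \<phi> = (\<integral>x. \<rho> x powr s * \<phi> x \<partial>lebesgue_on \<Omega>)" for \<phi> :: "real^'d \<Rightarrow> real"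
  \<comment> \<open>The common scale of both bounds. The error term of the upper bound is quadratic
    in it, hence negligible after division.\<close>
  define \<kappa> where "\<kappa> n = \<epsilon> n powr s" for n
  have \<kappa>0: "0 < \<kappa> n" for n using assms(8)[of n] by (simp add: \<kappa>_def)
  have "(\<lambda>n. \<epsilon> n powr s) \<longlonglongrightarrow> 0 powr s"
    using assms(8,9) s by (intro tendsto_powr2) (auto intro!: always_eventually less_imp_le)
  then have \<kappa>: "\<kappa> \<longlonglongrightarrow> 0" by (simp add: \<kappa>_def[abs_def])
  define \<mu>s where "\<mu>s n = \<mu>\<epsilon> (\<epsilon> n)" for n
  have \<mu>s: "\<mu>s n \<in> prob_measures_on \<Omega>"
    and min: "\<nu> \<in> prob_measures_on \<Omega> \<Longrightarrow> F_eps \<Omega> \<rho> p q (\<epsilon> n) (\<mu>s n) \<le> F_eps \<Omega> \<rho> p q (\<epsilon> n) \<nu>" for n \<nu>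
    using assms(7)[OF assms(8)[of n]] by (auto simp: \<mu>s_def is_arg_min_linorder)

  \<comment> \<open>Minimality against the competitors centred at \<open>y\<close>. They exist once
    \<open>\<kappa> n * M < 1\<close>, that is, once their density has mass below one.\<close>
  have upper: "\<exists>M D. 0 \<le> D \<and> (\<forall>\<^sub>F n in sequentially. F_eps \<Omega> \<rho> p q (\<epsilon> n) (\<mu>s n)
      \<le> ennreal (\<kappa> n * (c * J (\<lambda>x. max (dist x y) \<delta> powr b)) + D * (\<kappa> n * M)\<^sup>2))"
    if y: "y \<in> \<Omega>" and \<delta>: "0 < \<delta>" for y \<delta>
  proof -
    obtain M D where D: "0 \<le> D" and MD: "\<And>e. 0 < e \<Longrightarrow> e powr s * M \<le> 1 \<Longrightarrow> \<exists>\<nu>\<in>prob_measures_on \<Omega>.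
        F_eps \<Omega> \<rho> p q e \<nu> \<le> ennreal (e powr s * (c * J (\<lambda>x. max (dist x y) \<delta> powr b)) + D * (e powr s * M)\<^sup>2)"
      by (rule F_eps_upper[OF \<Omega> \<rho> pq y \<delta>, folded a_def, folded s_def t_def b_def, folded c_def J_def])
        (assumption, rule that)
    have "(\<lambda>n. \<kappa> n * M) \<longlonglongrightarrow> 0 * M" by (intro tendsto_intros \<kappa>)
    then have "\<forall>\<^sub>F n in sequentially. \<kappa> n * M < 1" by (rule order_tendstoD) simp
    then have "\<forall>\<^sub>F n in sequentially. F_eps \<Omega> \<rho> p q (\<epsilon> n) (\<mu>s n)
      \<le> ennreal (\<kappa> n * (c * J (\<lambda>x. max (dist x y) \<delta> powr b)) + D * (\<kappa> n * M)\<^sup>2)"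
    proof eventually_elim
      case (elim n)
      then show ?case using MD[OF assms(8)[of n]] min[of _ n] unfolding \<kappa>_def[symmetric]
        by (meson less_imp_le order_trans)
    qed
    then show ?thesis using D by blast
  qed

  \<comment> \<open>The interaction is at most the whole functional, whose minima vanish at rate
    \<open>\<kappa> n\<close>. Any \<open>y\<close> and any cut-off will do; a point
    \<open>y\<close> exists because a probability space is nonempty.\<close>
  have E: "(\<lambda>n. \<integral>\<^sup>+z. ennreal (dist (fst z) (snd z) powr q) \<partial>(\<mu>s n \<Otimes>\<^sub>M \<mu>s n)) \<longlonglongrightarrow> 0"
  proof -
    interpret prob_space \<mu> using \<mu> by (simp add: prob_measures_on_def)
    have "space \<mu> = \<Omega>"
      using \<mu> sets_eq_imp_space_eq[of \<mu> "restrict_space borel \<Omega>"]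
      by (simp add: prob_measures_on_def space_restrict_space)
    then obtain y where "y \<in> \<Omega>" using not_empty by blast
    from upper[OF this zero_less_one] obtain M D where
      ev: "\<forall>\<^sub>F n in sequentially. F_eps \<Omega> \<rho> p q (\<epsilon> n) (\<mu>s n)
        \<le> ennreal (\<kappa> n * (c * J (\<lambda>x. max (dist x y) 1 powr b)) + D * (\<kappa> n * M)\<^sup>2)" by blast
    have "(\<lambda>n. \<kappa> n * (c * J (\<lambda>x. max (dist x y) 1 powr b)) + D * (\<kappa> n * M)\<^sup>2)
        \<longlonglongrightarrow> 0 * (c * J (\<lambda>x. max (dist x y) 1 powr b)) + D * (0 * M)\<^sup>2"
      by (intro tendsto_intros \<kappa>)
    from tendsto_ennrealI[OF this]
    have up: "(\<lambda>n. ennreal (\<kappa> n * (c * J (\<lambda>x. max (dist x y) 1 powr b)) + D * (\<kappa> n * M)\<^sup>2)) \<longlonglongrightarrow> 0"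
      by simp
    show ?thesis
    proof (rule tendsto_sandwich[OF always_eventually _ tendsto_const up])
      show "\<forall>\<^sub>F n in sequentially. (\<integral>\<^sup>+z. ennreal (dist (fst z) (snd z) powr q) \<partial>(\<mu>s n \<Otimes>\<^sub>M \<mu>s n))
          \<le> ennreal (\<kappa> n * (c * J (\<lambda>x. max (dist x y) 1 powr b)) + D * (\<kappa> n * M)\<^sup>2)"
        using ev by eventually_elim (auto simp: F_eps_def intro: order_trans[OF add_increasing[OF zero_le order_refl]])
    qed simp
  qed
  obtain x0 where x0: "x0 \<in> \<Omega>" and \<mu>_eq: "\<mu> = return (restrict_space borel \<Omega>) x0"
    and I: "(\<lambda>n. \<integral>x. dist x x0 powr q \<partial>\<mu>s n) \<longlonglongrightarrow> 0"
    by (rule weak_star_concentration[OF comp pq(2) \<mu>s \<mu> assms(11)[folded \<mu>s_def] E]) (rule that)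

  \<comment> \<open>With the moments about \<open>x0\<close> tending to zero, every ball around
    \<open>x0\<close> eventually carries any prescribed mass below one.\<close>
  have ball: "\<forall>\<^sub>F n in sequentially. ennreal \<theta> \<le> emeasure (\<mu>s n) (\<Omega> \<inter> ball x0 r)"
    if r: "0 < r" and \<theta>: "\<theta> < 1" for r \<theta>
  proof -
    have "(\<lambda>n. 1 - (\<integral>x. dist x x0 powr q \<partial>\<mu>s n) / r powr q) \<longlonglongrightarrow> 1 - 0 / r powr q"
      using r by (intro tendsto_intros I) auto
    then have "\<forall>\<^sub>F n in sequentially. \<theta> < 1 - (\<integral>x. dist x x0 powr q \<partial>\<mu>s n) / r powr q"
      by (rule order_tendstoD) (use \<theta> in simp)
    then show ?thesis
    proof eventually_elim
      case (elim n)
      show ?case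
        by (rule order_trans[OF ennreal_leI[OF less_imp_le[OF elim]]
            emeasure_ball_lower[OF \<Omega>b \<mu>s pq(2) r integrable_dist_powr[OF \<Omega>(1) \<mu>s x0 pq(2)]]])
    qed
  qed

  \<comment> \<open>Sandwich the minimum between the two bounds, divide by \<open>\<kappa> n\<close>
    and let \<open>n\<close> grow: the error \<open>D * (\<kappa> n * M\<^sup>2)\<close> disappears,
    and \<open>c\<close> cancels.\<close>
  have key: "\<theta> powr t * J (\<lambda>x. max (dist x x0 - r) 0 powr b) \<le> J (\<lambda>x. max (dist x y) \<delta> powr b)"
    if y: "y \<in> \<Omega>" and \<delta>: "0 < \<delta>" and r: "0 < r" and \<theta>: "0 \<le> \<theta>" "\<theta> < 1" for y \<delta> r \<theta>
  proof -
    let ?H = "J (\<lambda>x. max (dist x x0 - r) 0 powr b)" and ?U = "J (\<lambda>x. max (dist x y) \<delta> powr b)"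
    from upper[OF y \<delta>] obtain M D where D: "0 \<le> D" and
      ev: "\<forall>\<^sub>F n in sequentially. F_eps \<Omega> \<rho> p q (\<epsilon> n) (\<mu>s n)
        \<le> ennreal (\<kappa> n * (c * ?U) + D * (\<kappa> n * M)\<^sup>2)" by blast
    have U0: "0 \<le> ?U" unfolding J_def by simp
    have "\<forall>\<^sub>F n in sequentially. c * \<theta> powr t * ?H \<le> c * ?U + D * (\<kappa> n * M\<^sup>2)"
      using ev ball[OF r \<theta>(2)]
    proof eventually_elim
      case (elim n)
      have "ennreal (\<kappa> n * (c * \<theta> powr t * ?H)) \<le> F_eps \<Omega> \<rho> p q (\<epsilon> n) (\<mu>s n)"
        using F_eps_lower[OF \<Omega> \<rho> pq assms(8)[of n] \<mu>s \<theta>(1) elim(2)]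
        unfolding a_def[symmetric] s_def[symmetric] t_def[symmetric] b_def[symmetric]
          c_def[symmetric] J_def[symmetric] \<kappa>_def[symmetric] .
      also note elim(1)
      finally have "\<kappa> n * (c * \<theta> powr t * ?H) \<le> \<kappa> n * (c * ?U) + D * (\<kappa> n * M)\<^sup>2"
        using c \<kappa>0[of n] D U0 by (subst (asm) ennreal_le_iff) auto
      also have "\<dots> = \<kappa> n * (c * ?U + D * (\<kappa> n * M\<^sup>2))"
        by (simp add: power2_eq_square algebra_simps)
      finally show ?case using \<kappa>0[of n] by simp
    qed
    moreover have "(\<lambda>n. c * ?U + D * (\<kappa> n * M\<^sup>2)) \<longlonglongrightarrow> c * ?U + D * (0 * M\<^sup>2)"
      by (intro tendsto_intros \<kappa>)
    ultimately have "c * \<theta> powr t * ?H \<le> c * ?U + D * (0 * M\<^sup>2)"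
      using tendsto_lowerbound[OF _ _ sequentially_bot] by blast
    then show ?thesis using c by (simp add: mult.assoc)
  qed

  have cost: "limit_cost \<Omega> \<rho> p q y = J (\<lambda>x. dist x y powr b)" for y
    by (simp add: limit_cost_def J_def Let_def a_def b_def s_def)
  \<comment> \<open>One sequence drives all three parameters: \<open>r\<close> and
    \<open>\<delta>\<close> are \<open>\<eta> k\<close>, and \<open>\<theta>\<close> is
    \<open>1 - \<eta> k\<close>. At \<open>k = 0\<close> this gives \<open>\<theta> = 0\<close>,
    which \<open>key\<close> admits.\<close>
  define \<eta> where "\<eta> k = inverse (real (Suc k))" for k
  have \<eta>: "0 < \<eta> k" "\<eta> k \<le> 1" for k by (auto simp: \<eta>_def field_simps)
  have \<eta>_lim: "\<eta> \<longlonglongrightarrow> 0" unfolding \<eta>_def[abs_def] by (rule LIMSEQ_inverse_real_of_nat)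
  have "limit_cost \<Omega> \<rho> p q x0 \<le> limit_cost \<Omega> \<rho> p q y" if y: "y \<in> \<Omega>" for y
  proof -
    have bounds: "dist x z \<le> diameter \<Omega>" if "x \<in> \<Omega>" "z \<in> \<Omega>" for x z
      by (rule diameter_bounded_bound[OF \<Omega>(1) that])
    have "(\<lambda>k. J (\<lambda>x. max (dist x x0 - \<eta> k) 0 powr b)) \<longlonglongrightarrow> J (\<lambda>x. dist x x0 powr b)"
      unfolding J_def
    proof (rule integral_powr_mult_tendsto[OF \<Omega> \<rho> less_imp_le[OF s(1)] s(2), where K = "diameter \<Omega> powr b"])
      fix x assume x: "x \<in> \<Omega>"
      have "(\<lambda>k. max (dist x x0 - \<eta> k) 0) \<longlonglongrightarrow> max (dist x x0 - 0) 0"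
        by (intro tendsto_intros \<eta>_lim)
      \<comment> \<open>At \<open>x = x0\<close> the base tends to 0, where continuity of the power
        rests on \<open>b > 0\<close>. The same happens at \<open>x = y\<close> for the other
        limit.\<close>
      then show "(\<lambda>k. max (dist x x0 - \<eta> k) 0 powr b) \<longlonglongrightarrow> dist x x0 powr b"
        using b by (intro tendsto_powr2[where b = b]) auto
      show "\<bar>max (dist x x0 - \<eta> k) 0 powr b\<bar> \<le> diameter \<Omega> powr b" for k
        using bounds[OF x x0] \<eta>(1)[of k] b by (auto intro!: powr_mono2 simp: diameter_ge_0[OF \<Omega>(1)])
    qed measurable
    moreover have "(\<lambda>k. (1 - \<eta> k) powr t) \<longlonglongrightarrow> (1 - 0) powr t"
      by (intro tendsto_intros \<eta>_lim) auto
    ultimately have "(\<lambda>k. (1 - \<eta> k) powr t * J (\<lambda>x. max (dist x x0 - \<eta> k) 0 powr b))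
        \<longlonglongrightarrow> (1 - 0) powr t * J (\<lambda>x. dist x x0 powr b)"
      by (intro tendsto_mult)
    moreover have "(\<lambda>k. J (\<lambda>x. max (dist x y) (\<eta> k) powr b)) \<longlonglongrightarrow> J (\<lambda>x. dist x y powr b)"
      unfolding J_def
    proof (rule integral_powr_mult_tendsto[OF \<Omega> \<rho> less_imp_le[OF s(1)] s(2), where K = "max (diameter \<Omega>) 1 powr b"])
      fix x assume x: "x \<in> \<Omega>"
      have "(\<lambda>k. max (dist x y) (\<eta> k)) \<longlonglongrightarrow> max (dist x y) 0"
        by (intro tendsto_intros \<eta>_lim)
      then show "(\<lambda>k. max (dist x y) (\<eta> k) powr b) \<longlonglongrightarrow> dist x y powr b"
        using b by (intro tendsto_powr2[where b = b]) (auto simp: le_max_iff_disj)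
      show "\<bar>max (dist x y) (\<eta> k) powr b\<bar> \<le> max (diameter \<Omega>) 1 powr b" for k
        using bounds[OF x y] \<eta>(2)[of k] b by (auto intro!: powr_mono2 simp: le_max_iff_disj)
    qed measurable
    \<comment> \<open>Pass to the limit in \<open>key\<close> on both sides; the factor
      \<open>(1 - \<eta> k) powr t\<close> tends to 1.\<close>
    ultimately have "(1 - 0) powr t * J (\<lambda>x. dist x x0 powr b) \<le> J (\<lambda>x. dist x y powr b)"
    proof (rule LIMSEQ_le, intro exI allI impI)
      show "(1 - \<eta> k) powr t * J (\<lambda>x. max (dist x x0 - \<eta> k) 0 powr b) \<le> J (\<lambda>x. max (dist x y) (\<eta> k) powr b)" for k
        using key[OF y \<eta>(1) \<eta>(1), of "1 - \<eta> k" k k] \<eta>[of k] by simp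
    qed
    then show ?thesis by (simp add: cost)
  qed
  then show ?thesis using x0 \<mu>_eq by (auto simp: is_arg_min_linorder)
qed

end
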